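(* Let $q=p^h$ with $p$ prime and $h>1$, and let $n\geq 2$. Let $v\in\mathbb{F}_p^{\theta_n}$ be the incidence vector of a small linear blocking set of $PG(n,q)$ that is not a hyperplane. Then $v\notin C(PG(n,q))$.
   Context: $C(PG(n,q))$ is the $\mathbb{F}_p$-span of the incidence vectors of the hyperplanes of $PG(n,q)$, with coordinates indexed by the $\theta_n=(q^{n+1}-1)/(q-1)$ points. Field reduction: points of $PG(n,q)$ correspond to the elements of the Desarguesian $(h-1)$-spread $\mathcal{D}$ of $PG(h(n+1)-1,p)$, obtained by viewing each $1$-dimensional $\mathbb{F}_q$-subspace of $\mathbb{F}_q^{n+1}$ as an $h$-dimensional $\mathbb{F}_p$-subspace of $\mathbb{F}_p^{h(n+1)}$. For a subspace $U$ of $PG(h(n+1)-1,p)$, $\mathcal{B}(U)$ is the set of spread elements meeting $U$, viewed as a point set of $PG(n,q)$. A small linear blocking set is $\mathcal{B}(U)$ with $\dim U=h(n-1)$. *)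

theory Defs
  imports Main "HOL-Number_Theory.Cong"
begin

definition vecs :: "nat \<Rightarrow> (nat \<Rightarrow> 'a::field) set" where
  "vecs n = {x. \<forall>i>n. x i = 0}"

definition pg_points :: "nat \<Rightarrow> (nat \<Rightarrow> 'a::field) set set" where
  "pg_points n = {{(\<lambda>i. c * v i) | c. True} | v. v \<in> vecs n \<and> v \<noteq> (\<lambda>i. 0)}"

definition pg_hyperplanes :: "nat \<Rightarrow> (nat \<Rightarrow> 'a::field) set set set" where
  "pg_hyperplanes n = {{P \<in> pg_points n. \<forall>x\<in>P. (\<Sum>i\<le>n. a i * x i) = 0} | a. a \<in> vecs n \<and> a \<noteq> (\<lambda>i. 0)}"

text \<open>F_p-linear structure on F_q^(n+1) (F_p the prime subfield, elements of_nat k).\<close>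
definition fp_span :: "(nat \<Rightarrow> 'a::field) set \<Rightarrow> (nat \<Rightarrow> 'a) set" where
  "fp_span S = {x. \<exists>c::(nat \<Rightarrow> 'a) \<Rightarrow> nat. x = (\<lambda>i. \<Sum>s\<in>S. of_nat (c s) * s i)}"

definition is_fp_subspace :: "nat \<Rightarrow> (nat \<Rightarrow> 'a::field) set \<Rightarrow> bool" where
  "is_fp_subspace n U \<longleftrightarrow> U \<subseteq> vecs n \<and> (\<lambda>i. 0) \<in> U \<and>
     (\<forall>x\<in>U. \<forall>y\<in>U. (\<lambda>i. x i + y i) \<in> U) \<and>
     (\<forall>x\<in>U. \<forall>k::nat. (\<lambda>i. of_nat k * x i) \<in> U)"

definition fp_dim :: "(nat \<Rightarrow> 'a::field) set \<Rightarrow> nat" where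
  "fp_dim U = (LEAST d. \<exists>S. finite S \<and> card S = d \<and> S \<subseteq> U \<and> fp_span S = U)"

definition B_of :: "nat \<Rightarrow> (nat \<Rightarrow> 'a::field) set \<Rightarrow> (nat \<Rightarrow> 'a) set set" where
  "B_of n U = {P \<in> pg_points n. \<exists>x\<in>P. x \<noteq> (\<lambda>i. 0) \<and> x \<in> U}"

text \<open>Small linear blocking set: B(U) with U of projective dimension h(n-1),
  i.e. F_p-vector dimension h(n-1)+1.\<close>
definition small_linear_blocking_set :: "nat \<Rightarrow> nat \<Rightarrow> (nat \<Rightarrow> 'a::field) set set \<Rightarrow> bool" where
  "small_linear_blocking_set h n B \<longleftrightarrow>
     (\<exists>U. is_fp_subspace n U \<and> fp_dim U = h * (n - 1) + 1 \<and> B = B_of n U)"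

text \<open>Incidence vector (over F_p = Z/pZ, values 0/1) of a point set.\<close>
definition incvec :: "'b set \<Rightarrow> 'b \<Rightarrow> int" where
  "incvec S P = (if P \<in> S then 1 else 0)"

definition in_code :: "nat \<Rightarrow> nat \<Rightarrow> ((nat \<Rightarrow> 'a::field) set \<Rightarrow> int) \<Rightarrow> bool" where
  "in_code p n v \<longleftrightarrow> (\<exists>c :: (nat \<Rightarrow> 'a) set set \<Rightarrow> int.
     \<forall>P\<in>pg_points n. [v P = (\<Sum>H\<in>pg_hyperplanes n. c H * incvec H P)] (mod int p))"

end

theory Submission
  imports Defs "HOL-Library.Function_Algebras" "HOL-Library.FuncSet"
    "HOL-Computational_Algebra.Polynomial"
begin

text \<open>
  Write \<open>B = \<B>(U)\<close> and \<open>q = p ^ h\<close>. If \<open>U\<close> lies in a hyperplane then, by a dimension count, \<open>B\<close> is that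
  hyperplane. Otherwise some secant line of \<open>B\<close> is not contained in \<open>B\<close>, and counting the planes through
  such a line gives one whose intersection with \<open>U\<close> has rank at most \<open>h + 1\<close> and still spans it. In this
  plane \<open>B\<close> has at most \<open>2q - 1\<close> points.

  Project these points from one of them, \<open>e\<close>. There are \<open>a \<ge> 2\<close> secant lines through \<open>e\<close>; let the
  poorest of them contain \<open>b\<close> points besides \<open>e\<close>. Linearity gives \<open>b \<ge> 2\<close>, and \<open>a b \<le> 2 (q - 1)\<close>, so
  \<open>(a - 1) + (b - 1) \<le> q - 1\<close>. Hence \<open>q - 1\<close> lines of the plane cover all points of \<open>B\<close> in the plane
  except exactly one: take the other \<open>a - 1\<close> lines through \<open>e\<close> and \<open>b - 1\<close> lines for the points of the
  poorest one.

  The product of the corresponding \<open>q - 1\<close> linear forms, extended by \<open>0\<close> outside the plane, sums to \<open>0\<close>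
  over every hyperplane, because its degree is less than \<open>2 (q - 1)\<close>; but over \<open>B\<close> it sums to a nonzero
  value, coming from the single uncovered point. So \<open>B\<close> is not orthogonal to this dual word.
\<close>

section \<open>Additive subgroups and finite fields\<close>

text \<open>An additive subgroup, given by differences alone so that one counting lemma serves both
  the subspaces over the prime field and those over the whole field.\<close>

definition diff_closed :: "'b::ab_group_add set \<Rightarrow> bool" where
  "diff_closed A \<longleftrightarrow> 0 \<in> A \<and> (\<forall>x\<in>A. \<forall>y\<in>A. x - y \<in> A)"

lemma diff_closed_Int: "diff_closed A \<Longrightarrow> diff_closed B \<Longrightarrow> diff_closed (A \<inter> B)"
  by (auto simp: diff_closed_def)

text \<open>The differences \<open>x - y\<close> map \<open>A \<times> B\<close> into
  \<open>C\<close>. Two pairs with the same difference differ by the same element in both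
  coordinates, an element of \<open>A \<inter> B\<close>, so every fibre has at most
  \<open>card (A \<inter> B)\<close> members. This replaces the bound
  \<open>dim A + dim B \<le> dim C + dim (A \<inter> B)\<close>.\<close>

lemma card_mult_le_card_Int:
  fixes A B C :: "'b::ab_group_add set"
  assumes "finite C" "A \<subseteq> C" "B \<subseteq> C" "diff_closed A" "diff_closed B" "diff_closed C"
  shows "card A * card B \<le> card C * card (A \<inter> B)"
proof -
  have fin: "finite A" "finite B" using assms finite_subset by blast+
  define F where "F z = {w \<in> A \<times> B. fst w - snd w = z}" for z
  have "x - y \<in> C" if "x \<in> A" "y \<in> B" for x y
    using assms(2,3,6) that unfolding diff_closed_def by blast
  then have "A \<times> B \<subseteq> (\<Union>z\<in>C. F z)"
    by (auto simp: F_def)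
  moreover have finF: "finite (F z)" for z
    using fin by (auto simp: F_def)
  ultimately have "card (A \<times> B) \<le> card (\<Union>z\<in>C. F z)"
    using assms(1) by (intro card_mono) auto
  also have "\<dots> \<le> (\<Sum>z\<in>C. card (F z))"
    by (rule card_UN_le[OF assms(1)])
  also have "\<dots> \<le> (\<Sum>z\<in>C. card (A \<inter> B))"
  proof (rule sum_mono)
    fix z assume "z \<in> C"
    show "card (F z) \<le> card (A \<inter> B)"
    proof (cases "F z = {}")
      case False
      then obtain w where w: "w \<in> F z" by blast
      have "inj_on (\<lambda>v. fst v - fst w) (F z)"
        unfolding F_def inj_on_def by (auto simp: algebra_simps)
      moreover have "(\<lambda>v. fst v - fst w) ` F z \<subseteq> A \<inter> B"
      proof
        fix y assume "y \<in> (\<lambda>v. fst v - fst w) ` F z"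
        then obtain v where v: "v \<in> F z" "y = fst v - fst w" by blast
        have "y = snd v - snd w"
          using v w by (auto simp: F_def algebra_simps)
        then show "y \<in> A \<inter> B"
          using v w assms(4,5) unfolding F_def diff_closed_def mem_Collect_eq mem_Times_iff
          by (metis IntI)
      qed
      ultimately show ?thesis
        using card_inj_on_le[of _ "F z" "A \<inter> B"] fin by blast
    qed simp
  qed
  finally show ?thesis using fin by (simp add: card_cartesian_product)
qed

text \<open>Translation by 1 permutes the field, so summing all elements gives
  \<open>p ^ h = 0\<close>, and a field has no nonzero nilpotents.\<close>

lemma of_nat_prime_eq_0:
  assumes "prime p" "card (UNIV :: 'a::{finite,field} set) = p ^ h"
  shows "of_nat p = (0::'a)"
proof -
  have "(\<Sum>x\<in>UNIV. x + 1) = (\<Sum>x\<in>UNIV. x::'a)"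
    by (rule sum.reindex_bij_witness[of _ "\<lambda>x. x - 1" "\<lambda>x. x + 1"]) auto
  then have "of_nat (card (UNIV :: 'a set)) = (0::'a)"
    by (simp add: sum.distrib)
  then show ?thesis by (simp add: assms(2))
qed

lemma of_nat_less_prime_neq_0:
  assumes "prime p" "card (UNIV :: 'a::{finite,field} set) = p ^ h" "0 < k" "k < p"
  shows "of_nat k \<noteq> (0::'a)"
proof
  assume "of_nat k = (0::'a)"
  then have "CHAR('a) dvd k" by (simp add: of_nat_eq_0_iff_char_dvd)
  moreover have "CHAR('a) dvd p"
    using of_nat_prime_eq_0[OF assms(1,2)] by (simp add: of_nat_eq_0_iff_char_dvd)
  moreover have "CHAR('a) \<noteq> 1" by simp
  ultimately have "p dvd k" using assms(1) by (metis prime_nat_iff)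
  then show False using assms(3,4) by (auto dest: dvd_imp_le)
qed

lemma power_card_minus_1:
  fixes x :: "'a::{finite,field}"
  assumes "x \<noteq> 0"
  shows "x ^ (card (UNIV :: 'a set) - 1) = 1"
proof -
  have "(\<Prod>y\<in>UNIV-{0}. x * y) = (\<Prod>y\<in>UNIV-{0}. y)"
    by (rule prod.reindex_bij_witness[of _ "\<lambda>y. y / x" "\<lambda>y. x * y"]) (use assms in auto)
  moreover have "(\<Prod>y\<in>UNIV-{0}. x * y) = x ^ (card (UNIV :: 'a set) - 1) * \<Prod>(UNIV-{0})"
    by (simp add: prod.distrib)
  moreover have "\<Prod>(UNIV-{0::'a}) \<noteq> 0" by simp
  ultimately show ?thesis by simp
qed

text \<open>For \<open>j > 0\<close> the polynomial \<open>X ^ j - 1\<close> has at most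
  \<open>j\<close> roots, so some nonzero \<open>g\<close> has \<open>g ^ j \<noteq> 1\<close>, and
  replacing \<open>x\<close> by \<open>g * x\<close> multiplies the sum by \<open>g ^ j\<close>. For
  \<open>j = 0\<close> the sum is the field size, with \<open>0 ^ 0 = 1\<close>.\<close>

lemma sum_power_eq_0:
  assumes "j < card (UNIV :: 'a::{finite,field} set) - 1"
  shows "(\<Sum>x\<in>UNIV. x ^ j) = (0::'a)"
proof (cases "j = 0")
  case True
  have "(\<Sum>x\<in>UNIV. x + 1) = (\<Sum>x\<in>UNIV. x::'a)"
    by (rule sum.reindex_bij_witness[of _ "\<lambda>x. x - 1" "\<lambda>x. x + 1"]) auto
  then show ?thesis using True by (simp add: sum.distrib)
next
  case False
  define P :: "'a poly" where "P = monom 1 j - 1"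
  have "coeff P j = 1" using False by (simp add: P_def)
  then have "P \<noteq> 0" by auto
  moreover have "degree P \<le> j"
    unfolding P_def by (intro degree_diff_le) (auto simp: degree_monom_le)
  ultimately have "card {x. poly P x = 0} \<le> j"
    using card_poly_roots_bound[of P] by simp
  then have "card {x. poly P x = 0} < card (UNIV - {0::'a})"
    using assms by simp
  then have "\<not> UNIV - {0} \<subseteq> {x. poly P x = 0}"
    using card_mono[of "{x. poly P x = 0}" "UNIV - {0}"] by fastforce
  then obtain g where "g \<noteq> 0" "poly P g \<noteq> 0" by blast
  then have g: "g \<noteq> 0" "g ^ j \<noteq> 1"
    by (auto simp: P_def poly_monom)
  have "(\<Sum>x\<in>UNIV. x ^ j) = (\<Sum>x\<in>UNIV. (g * x) ^ j)"
    by (rule sum.reindex_bij_witness[of _ "\<lambda>y. g * y" "\<lambda>y. y / g"]) (use g in auto)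
  also have "\<dots> = g ^ j * (\<Sum>x\<in>UNIV. x ^ j)"
    by (simp add: power_mult_distrib sum_distrib_left)
  finally show ?thesis using g by simp
qed

section \<open>Sums of products of few linear forms\<close>

text \<open>A monomial in two variables sums to 0 unless both exponents reach the field size minus
  1. The monomial factor is carried along for the induction: multiplying out one form raises one
  exponent by at most 1 and shortens the list by 1, so the bound persists.\<close>

lemma sum_prod_affine_forms_eq_0:
  fixes fs :: "('a::{finite,field} \<times> 'a \<times> 'a) list"
  assumes "j + k + length fs < 2 * (card (UNIV :: 'a set) - 1)"
  shows "(\<Sum>a\<in>UNIV. \<Sum>b\<in>UNIV. a ^ j * b ^ k * (\<Prod>(A, B, C)\<leftarrow>fs. A * a + B * b + C)) = 0"
  using assms
proof (induction fs arbitrary: j k)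
  case Nil
  then have "j < card (UNIV :: 'a set) - 1 \<or> k < card (UNIV :: 'a set) - 1"
    by simp linarith
  then show ?case
    by (auto simp: sum_power_eq_0 simp flip: sum_product sum_distrib_left sum_distrib_right)
next
  case (Cons f fs)
  obtain A B C where f: "f = (A, B, C)" by (cases f)
  let ?P = "\<lambda>a b. \<Prod>(A, B, C)\<leftarrow>fs. A * a + B * b + C"
  have "a ^ j * b ^ k * (\<Prod>(A, B, C)\<leftarrow>f # fs. A * a + B * b + C) =
      A * (a ^ Suc j * b ^ k * ?P a b) + B * (a ^ j * b ^ Suc k * ?P a b) + C * (a ^ j * b ^ k * ?P a b)"
    for a b by (simp add: f algebra_simps)
  then have "(\<Sum>a\<in>UNIV. \<Sum>b\<in>UNIV. a ^ j * b ^ k * (\<Prod>(A, B, C)\<leftarrow>f # fs. A * a + B * b + C)) =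
      A * (\<Sum>a\<in>UNIV. \<Sum>b\<in>UNIV. a ^ Suc j * b ^ k * ?P a b) +
      B * (\<Sum>a\<in>UNIV. \<Sum>b\<in>UNIV. a ^ j * b ^ Suc k * ?P a b) +
      C * (\<Sum>a\<in>UNIV. \<Sum>b\<in>UNIV. a ^ j * b ^ k * ?P a b)"
    by (simp only: sum.distrib sum_distrib_left)
  then show ?case
    using Cons.IH[of "Suc j" k] Cons.IH[of j "Suc k"] Cons.IH[of j k] Cons.prems by simp
qed

section \<open>Linear forms on coordinate triples of a plane\<close>

definition dot3 :: "'a::field \<times> 'a \<times> 'a \<Rightarrow> 'a \<times> 'a \<times> 'a \<Rightarrow> 'a" where
  "dot3 f t = (case (f, t) of ((A, B, C), (a, b, c)) \<Rightarrow> A * a + B * b + C * c)"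

definition scale3 :: "'a::field \<Rightarrow> 'a \<times> 'a \<times> 'a \<Rightarrow> 'a \<times> 'a \<times> 'a" where
  "scale3 k t = (case t of (a, b, c) \<Rightarrow> (k * a, k * b, k * c))"

lemma dot3_scale3: "dot3 f (scale3 k t) = k * dot3 f t"
  by (cases f; cases t) (simp add: dot3_def scale3_def algebra_simps)

text \<open>A coordinate with nonzero coefficient in \<open>m\<close> can be eliminated, which
  leaves a sum over two free variables of a product of linear forms. In the application
  \<open>m\<close> is the equation of a hyperplane restricted to the plane.\<close>

lemma sum_forms_on_plane_section_eq_0:
  fixes fs :: "('a::{finite,field} \<times> 'a \<times> 'a) list"
  assumes len: "length fs < 2 * (card (UNIV :: 'a set) - 1)"
  shows "(\<Sum>t\<in>{t. dot3 m t = 0}. \<Prod>f\<leftarrow>fs. dot3 f t) = 0"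
proof -
  obtain \<alpha> \<beta> \<gamma> where m: "m = (\<alpha>, \<beta>, \<gamma>)" by (cases m)
  let ?g = "\<lambda>t. \<Prod>f\<leftarrow>fs. dot3 f t"
  have affine: "(\<Sum>x\<in>UNIV. \<Sum>y\<in>UNIV. \<Prod>f\<leftarrow>fs. \<phi>1 f * x + \<phi>2 f * y + \<phi>3 f) = 0"
    for \<phi>1 \<phi>2 \<phi>3 :: "'a \<times> 'a \<times> 'a \<Rightarrow> 'a"
    using sum_prod_affine_forms_eq_0[of 0 0 "map (\<lambda>f. (\<phi>1 f, \<phi>2 f, \<phi>3 f)) fs"] len
    by (simp add: comp_def)
  have pair: "(\<Sum>x\<in>UNIV. \<Sum>y\<in>UNIV. F x y) = (\<Sum>w\<in>UNIV. F (fst w) (snd w))"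
    for F :: "'a \<Rightarrow> 'a \<Rightarrow> 'a"
    by (simp add: sum.cartesian_product case_prod_beta)
  have solve: "r = - s / d" if "d \<noteq> 0" "s + d * r = 0" for d r s :: 'a
    using that by (simp add: field_simps eq_neg_iff_add_eq_0)
  consider "\<gamma> \<noteq> 0" | "\<beta> \<noteq> 0" | "\<alpha> \<noteq> 0" | "\<alpha> = 0" "\<beta> = 0" "\<gamma> = 0" by blast
  then show ?thesis
  proof cases
    case 1
    define \<phi> where "\<phi> w = (fst w, snd w, - (\<alpha> * fst w + \<beta> * snd w) / \<gamma>)" for w
    have "{t. dot3 m t = 0} = range \<phi>"
    proof (intro equalityI subsetI)
      fix t assume "t \<in> {t. dot3 m t = 0}"
      moreover obtain a b c where t: "t = (a, b, c)" by (cases t)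
      ultimately have "\<alpha> * a + \<beta> * b + \<gamma> * c = 0" by (simp add: dot3_def m algebra_simps)
      from solve[OF 1 this] have "\<phi> (a, b) = t" by (simp add: t \<phi>_def)
      then show "t \<in> range \<phi>" by blast
    qed (use 1 in \<open>auto simp: dot3_def m \<phi>_def\<close>)
    moreover have "inj \<phi>" by (auto simp: inj_def \<phi>_def)
    ultimately have "(\<Sum>t\<in>{t. dot3 m t = 0}. ?g t) = (\<Sum>w\<in>UNIV. ?g (\<phi> w))"
      by (simp add: sum.reindex)
    also have "\<dots> = (\<Sum>x\<in>UNIV. \<Sum>y\<in>UNIV. \<Prod>f\<leftarrow>fs. (fst f - snd (snd f) * \<alpha> / \<gamma>) * x +
         (fst (snd f) - snd (snd f) * \<beta> / \<gamma>) * y + 0)"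
      unfolding pair
      by (intro sum.cong refl arg_cong[of _ _ prod_list] map_cong)
        (use 1 in \<open>auto simp: dot3_def \<phi>_def field_simps\<close>)
    finally show ?thesis by (simp only: affine)
  next
    case 2
    define \<phi> where "\<phi> w = (fst w, - (\<alpha> * fst w + \<gamma> * snd w) / \<beta>, snd w)" for w
    have "{t. dot3 m t = 0} = range \<phi>"
    proof (intro equalityI subsetI)
      fix t assume "t \<in> {t. dot3 m t = 0}"
      moreover obtain a b c where t: "t = (a, b, c)" by (cases t)
      ultimately have "\<alpha> * a + \<gamma> * c + \<beta> * b = 0" by (simp add: dot3_def m algebra_simps)
      from solve[OF 2 this] have "\<phi> (a, c) = t" by (simp add: t \<phi>_def)
      then show "t \<in> range \<phi>" by blast
    qed (use 2 in \<open>auto simp: dot3_def m \<phi>_def\<close>)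
    moreover have "inj \<phi>" by (auto simp: inj_def \<phi>_def)
    ultimately have "(\<Sum>t\<in>{t. dot3 m t = 0}. ?g t) = (\<Sum>w\<in>UNIV. ?g (\<phi> w))"
      by (simp add: sum.reindex)
    also have "\<dots> = (\<Sum>x\<in>UNIV. \<Sum>y\<in>UNIV. \<Prod>f\<leftarrow>fs. (fst f - fst (snd f) * \<alpha> / \<beta>) * x +
         (snd (snd f) - fst (snd f) * \<gamma> / \<beta>) * y + 0)"
      unfolding pair
      by (intro sum.cong refl arg_cong[of _ _ prod_list] map_cong)
        (use 2 in \<open>auto simp: dot3_def \<phi>_def field_simps\<close>)
    finally show ?thesis by (simp only: affine)
  next
    case 3
    define \<phi> where "\<phi> w = (- (\<beta> * fst w + \<gamma> * snd w) / \<alpha>, fst w, snd w)" for w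
    have "{t. dot3 m t = 0} = range \<phi>"
    proof (intro equalityI subsetI)
      fix t assume "t \<in> {t. dot3 m t = 0}"
      moreover obtain a b c where t: "t = (a, b, c)" by (cases t)
      ultimately have "\<beta> * b + \<gamma> * c + \<alpha> * a = 0" by (simp add: dot3_def m algebra_simps)
      from solve[OF 3 this] have "\<phi> (b, c) = t" by (simp add: t \<phi>_def)
      then show "t \<in> range \<phi>" by blast
    qed (use 3 in \<open>auto simp: dot3_def m \<phi>_def\<close>)
    moreover have "inj \<phi>" by (auto simp: inj_def \<phi>_def)
    ultimately have "(\<Sum>t\<in>{t. dot3 m t = 0}. ?g t) = (\<Sum>w\<in>UNIV. ?g (\<phi> w))"
      by (simp add: sum.reindex)
    also have "\<dots> = (\<Sum>x\<in>UNIV. \<Sum>y\<in>UNIV. \<Prod>f\<leftarrow>fs. (fst (snd f) - fst f * \<beta> / \<alpha>) * x +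
         (snd (snd f) - fst f * \<gamma> / \<alpha>) * y + 0)"
      unfolding pair
      by (intro sum.cong refl arg_cong[of _ _ prod_list] map_cong)
        (use 3 in \<open>auto simp: dot3_def \<phi>_def field_simps\<close>)
    finally show ?thesis by (simp only: affine)
  next
    \<comment> \<open>Here the hyperplane contains the whole plane. The first coordinate is fixed
      and enters the constant terms, so each inner sum over the other two vanishes.\<close>
    case 4
    have "(\<Sum>t\<in>{t. dot3 m t = 0}. ?g t) = (\<Sum>t\<in>UNIV \<times> UNIV. ?g t)"
      using 4 by (intro sum.cong) (auto simp: dot3_def m)
    also have "\<dots> = (\<Sum>c\<in>UNIV. \<Sum>x\<in>UNIV. \<Sum>y\<in>UNIV. ?g (c, x, y))"
      by (simp add: sum.cartesian_product flip: UNIV_Times_UNIV)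
    also have "\<dots> = (\<Sum>c\<in>UNIV. \<Sum>x\<in>UNIV. \<Sum>y\<in>UNIV. \<Prod>f\<leftarrow>fs. fst (snd f) * x +
         snd (snd f) * y + fst f * c)"
      by (intro sum.cong refl arg_cong[of _ _ prod_list] map_cong)
        (auto simp: dot3_def field_simps)
    finally show ?thesis by (simp only: affine sum.neutral_const)
  qed
qed

lemma inj_on_of_nat_less_prime:
  assumes "prime p" "card (UNIV :: 'a::{finite,field} set) = p ^ h"
  shows "inj_on (of_nat :: nat \<Rightarrow> 'a) {..<p}"
proof (rule inj_onI)
  fix x y :: nat
  assume "x \<in> {..<p}" "y \<in> {..<p}" "of_nat x = (of_nat y :: 'a)"
  moreover have False if "u < v" "v < p" "of_nat u = (of_nat v :: 'a)" for u v :: nat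
    using of_nat_less_prime_neq_0[OF assms, of "v - u"] that less_imp_diff_less[of v p u]
    by (simp add: of_nat_diff)
  ultimately show "x = y" by (metis lessThan_iff linorder_neqE_nat)
qed

text \<open>Repeating a member pads the list. A number of forms equal to the field size minus 1 is
  wanted exactly, since their product is then constant on the nonzero vectors of a point.\<close>

lemma list_of_set_with_length:
  assumes "finite F" "F \<noteq> {}" "card F \<le> m"
  obtains fs where "set fs = F" "length fs = m"
proof -
  obtain xs where xs: "set xs = F" "distinct xs"
    using finite_distinct_list[OF assms(1)] by blast
  obtain f where "f \<in> F" using assms(2) by blast
  then have "set (xs @ replicate (m - length xs) f) = F"
    using xs by auto
  moreover have "length (xs @ replicate (m - length xs) f) = m"
    using xs assms(3) distinct_card[of xs] by simp
  ultimately show ?thesis by (rule that)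
qed

section \<open>Covering all but one point of a plane linear set\<close>

text \<open>
  Projection from the point \<open>(1, 0, 0)\<close>: \<open>slope\<close> identifies the line joining a point to the centre and
  \<open>position\<close> the point on that line. Both are junk at the centre itself.
\<close>

fun slope :: "'a::field \<times> 'a \<times> 'a \<Rightarrow> 'a option" where
  "slope (a, b, c) = (if c \<noteq> 0 then Some (b / c) else None)"

fun position :: "'a::field \<times> 'a \<times> 'a \<Rightarrow> 'a" where
  "position (a, b, c) = (if c \<noteq> 0 then a / c else a / b)"

text \<open>The equation of the line through the centre with slope \<open>s\<close>;
  \<open>None\<close> stands for the line on which the third coordinate vanishes.\<close>

definition line_form :: "'a::field option \<Rightarrow> 'a \<times> 'a \<times> 'a" where
  "line_form s = (case s of Some m \<Rightarrow> (0, 1, -m) | None \<Rightarrow> (0, 0, 1))"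

text \<open>The equation of a line that avoids the centre and meets the line of slope
  \<open>s\<close> in the point of position \<open>y\<close>.\<close>

definition point_form :: "'a::field option \<Rightarrow> 'a \<Rightarrow> 'a \<times> 'a \<times> 'a" where
  "point_form s y = (case s of Some m \<Rightarrow> (1, 0, -y) | None \<Rightarrow> (1, -y, 0))"

lemma dot3_line_form: "snd t \<noteq> (0, 0) \<Longrightarrow> dot3 (line_form s) t = 0 \<longleftrightarrow> slope t = s"
  by (cases t; cases s) (auto simp: dot3_def line_form_def field_simps)

lemma dot3_line_form_centre: "snd t = (0, 0) \<Longrightarrow> dot3 (line_form s) t = 0"
  by (cases t; cases s) (auto simp: dot3_def line_form_def)

lemma dot3_point_form: "snd t \<noteq> (0, 0) \<Longrightarrow> dot3 (point_form (slope t) y) t = 0 \<longleftrightarrow> position t = y"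
  by (cases t) (auto simp: dot3_def point_form_def field_simps)

lemma scale3_of_slope_position:
  assumes "snd t \<noteq> (0, 0)" "snd P \<noteq> (0, 0)" "slope t = slope P" "position t = position P"
  shows "\<exists>k. t = scale3 k P"
proof -
  obtain a b c where t: "t = (a, b, c)" by (cases t)
  obtain a' b' c' where P: "P = (a', b', c')" by (cases P)
  show ?thesis
  proof (cases "c = 0")
    case True
    then have "c' = 0" using assms t P by (auto split: if_splits)
    with True have "t = scale3 (b / b') P"
      using assms t P by (auto simp: scale3_def field_simps)
    then show ?thesis by blast
  next
    case False
    then have "c' \<noteq> 0" using assms t P by (auto split: if_splits)
    with False have "t = scale3 (c / c') P"
      using assms t P by (auto simp: scale3_def field_simps)
    then show ?thesis by blast
  qed
qed

lemma slope_scale3: "k \<noteq> 0 \<Longrightarrow> slope (scale3 k t) = slope t"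
  by (cases t) (auto simp: scale3_def)

lemma position_scale3: "k \<noteq> 0 \<Longrightarrow> position (scale3 k t) = position t"
  by (cases t) (auto simp: scale3_def)

text \<open>In the application \<open>T\<close> consists of the coordinate triples of the vectors of
  \<open>U\<close> in the plane. The pairs in \<open>D\<close> are the points of the linear set
  other than the centre, \<open>S\<close> lists the secants through the centre, and
  \<open>Fib s\<close> the points on one of them.\<close>

lemma exists_covering_forms:
  fixes T :: "('a::{finite,field} \<times> 'a \<times> 'a) set"
  assumes p: "prime p" and q: "card (UNIV :: 'a set) = p ^ h"
    and units: "(1, 0, 0) \<in> T" "(0, 1, 0) \<in> T" "(0, 0, 1) \<in> T"
    and shift: "\<And>a b c. (a, b, c) \<in> T \<Longrightarrow> (a + 1, b, c) \<in> T"
    and scale: "\<And>k t. t \<in> T \<Longrightarrow> scale3 (of_nat k) t \<in> T"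
    and small: "card T \<le> p * card (UNIV :: 'a set)"
  obtains fs P where "length fs = card (UNIV :: 'a set) - 1" "P \<in> T"
    "\<And>f. f \<in> set fs \<Longrightarrow> dot3 f P \<noteq> 0"
    "\<And>t. t \<in> T \<Longrightarrow> (\<And>f. f \<in> set fs \<Longrightarrow> dot3 f t \<noteq> 0) \<Longrightarrow> \<exists>k. t = scale3 k P"
proof -
  define Q where "Q = card (UNIV :: 'a set)"
  define T' where "T' = {t \<in> T. snd t \<noteq> (0, 0)}"
  define \<phi> where "\<phi> t = (slope t, position t)" for t :: "'a \<times> 'a \<times> 'a"
  define D where "D = \<phi> ` T'"
  define S where "S = fst ` D"
  define Fib where "Fib s = {y. (s, y) \<in> D}" for s
  have p2: "p \<ge> 2" using p by (rule prime_ge_2_nat)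
  have injp: "inj_on (of_nat :: nat \<Rightarrow> 'a) {..<p}" by (rule inj_on_of_nat_less_prime[OF p q])
  have fin: "finite X" for X :: "('a \<times> 'a \<times> 'a) set" by simp
  have finD: "finite D" by (simp add: D_def)
  have finF: "finite (Fib s)" for s by simp
  have finS: "finite S" using finD by (simp add: S_def)

  \<comment> \<open>The centre alone uses up \<open>p\<close> vectors of \<open>T\<close>, zero
    included.\<close>
  have cardT': "card T' + p \<le> p * Q"
  proof -
    define Z where "Z = (\<lambda>k. scale3 (of_nat k :: 'a) (1, 0, 0)) ` {..<p}"
    have "card Z = p"
      unfolding Z_def using injp
      by (subst card_image) (auto simp: inj_on_def scale3_def)
    moreover have "Z \<subseteq> T" using scale units by (auto simp: Z_def)
    moreover have "Z \<inter> T' = {}" by (auto simp: Z_def T'_def scale3_def)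
    moreover have "T' \<subseteq> T" by (auto simp: T'_def)
    ultimately have "p + card T' \<le> card T"
      by (metis (no_types, lifting) card_Un_disjoint card_mono fin Un_least)
    then show ?thesis using small by (simp add: Q_def)
  qed
  \<comment> \<open>A point of \<open>D\<close> carries the \<open>p - 1\<close> nonzero prime-field
    multiples of any of its vectors.\<close>
  have fibre: "p - 1 \<le> card {t \<in> T'. \<phi> t = d}" if d: "d \<in> D" for d
  proof -
    obtain t where t: "t \<in> T'" "d = \<phi> t" using d by (auto simp: D_def)
    let ?m = "\<lambda>k. scale3 (of_nat k :: 'a) t"
    have nz: "of_nat k \<noteq> (0::'a)" if "k \<in> {1..<p}" for k
      using of_nat_less_prime_neq_0[OF p q] that by simp
    have "inj_on ?m {1..<p}"
    proof (rule inj_onI)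
      fix x y assume xy: "x \<in> {1..<p}" "y \<in> {1..<p}" "?m x = ?m y"
      then have "of_nat x = (of_nat y :: 'a)"
        using t by (cases t) (auto simp: T'_def scale3_def)
      then show "x = y" using injp xy by (auto simp: inj_on_def)
    qed
    moreover have "?m ` {1..<p} \<subseteq> {t \<in> T'. \<phi> t = d}"
    proof (rule image_subsetI)
      fix k assume k: "k \<in> {1..<p}"
      have "?m k \<in> T'"
        using t scale[of t k] nz[OF k] by (cases t) (auto simp: T'_def scale3_def)
      then show "?m k \<in> {t \<in> T'. \<phi> t = d}"
        using nz[OF k] t by (simp add: \<phi>_def slope_scale3 position_scale3)
    qed
    ultimately have "card {1..<p} \<le> card {t \<in> T'. \<phi> t = d}"
      by (metis (no_types, lifting) card_inj_on_le fin)
    then show ?thesis by simp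
  qed
  have "card T' = (\<Sum>d\<in>D. card {t \<in> T'. \<phi> t = d})"
    using sum.image_gen[of T' "\<lambda>_. 1::nat" \<phi>] by (simp add: D_def)
  also have "\<dots> \<ge> (\<Sum>d\<in>D. p - 1)"
    by (intro sum_mono fibre)
  finally have "card D * (p - 1) \<le> card T'" by simp
  also have "card T' \<le> p * (Q - 1)" using cardT' by (simp add: diff_mult_distrib2)
  \<comment> \<open>The estimate \<open>p \<le> 2 * (p - 1)\<close> frees the bound on the number of
    points from \<open>p\<close>.\<close>
  also have "\<dots> \<le> (2 * (p - 1)) * (Q - 1)"
    using p2 by (intro mult_le_mono1) simp
  finally have "card D * (p - 1) \<le> (2 * (Q - 1)) * (p - 1)" by (simp add: mult_ac)
  then have cardD: "card D \<le> 2 * (Q - 1)" using p2 by simp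

  have in_D: "\<phi> t \<in> D" if "t \<in> T'" for t using that by (simp add: D_def)
  have "(0, 1, 0) \<in> T'" "(0, 0, 1) \<in> T'" using units by (auto simp: T'_def)
  then have "fst (\<phi> (0, 1, 0)) \<in> S" "fst (\<phi> (0, 0, 1)) \<in> S"
    unfolding S_def by (auto intro!: imageI in_D)
  then have S2: "None \<in> S" "Some 0 \<in> S" by (simp_all add: \<phi>_def)
  then have "card {None, Some (0::'a)} \<le> card S"
    by (intro card_mono finS) auto
  then have a2: "card S \<ge> 2" by simp
  \<comment> \<open>Adding the centre to a vector keeps its slope and changes its position, which
    yields a second point on the same secant.\<close>
  have b2: "card (Fib s) \<ge> 2" if s: "s \<in> S" for s
  proof -
    obtain t where t: "t \<in> T'" "s = slope t" using s unfolding S_def D_def \<phi>_def by force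
    obtain a b c where abc: "t = (a, b, c)" by (cases t)
    have "(a + 1, b, c) \<in> T'" using t shift[of a b c] by (auto simp: abc T'_def)
    from in_D[OF this] in_D[OF t(1)]
    have "{position (a, b, c), position (a + 1, b, c)} \<subseteq> Fib s"
      using t(2) by (auto simp: Fib_def \<phi>_def abc)
    moreover have "position (a, b, c) \<noteq> position (a + 1, b, c)"
      using t(1) by (auto simp: T'_def abc)
    ultimately show ?thesis using card_mono[OF finF] by (metis card_2_iff)
  qed
  obtain s0 where s0: "s0 \<in> S" "\<And>s. s \<in> S \<Longrightarrow> card (Fib s0) \<le> card (Fib s)"
    using ex_has_least_nat[of "\<lambda>s. s \<in> S" None "\<lambda>s. card (Fib s)"] S2 by blast
  have "card S * card (Fib s0) \<le> (\<Sum>s\<in>S. card (Fib s))"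
    using sum_mono[of S "\<lambda>_. card (Fib s0)" "\<lambda>s. card (Fib s)"] s0 by simp
  also have "\<dots> = card (SIGMA s:S. Fib s)" using finS by (simp add: card_SigmaI)
  also have "(SIGMA s:S. Fib s) = D" by (force simp: S_def Fib_def)
  finally have prod_le: "card S * card (Fib s0) \<le> 2 * (Q - 1)" using cardD by simp
  \<comment> \<open>With \<open>a' + 2\<close> and \<open>b' + 2\<close> for the two factors,
    \<open>prod_le\<close> reads
    \<open>a' * b' + 2 * (a' + b' + 2) \<le> 2 * (Q - 1)\<close>.\<close>
  have sum_le: "(card S - 1) + (card (Fib s0) - 1) \<le> Q - 1"
  proof -
    obtain a' b' where ab: "card S = a' + 2" "card (Fib s0) = b' + 2"
      using a2 b2[OF s0(1)] by (metis add.commute le_iff_add)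
    then show ?thesis using prod_le by (simp add: algebra_simps)
  qed

  obtain y0 where y0: "y0 \<in> Fib s0" using b2[OF s0(1)] by fastforce
  then obtain P where "P \<in> T'" "(s0, y0) = \<phi> P" unfolding Fib_def D_def by blast
  then have P: "P \<in> T'" "slope P = s0" "position P = y0" by (simp_all add: \<phi>_def)
  define F where "F = line_form ` (S - {s0}) \<union> point_form s0 ` (Fib s0 - {y0})"
  have "card F \<le> card (line_form ` (S - {s0})) + card (point_form s0 ` (Fib s0 - {y0}))"
    unfolding F_def by (rule card_Un_le)
  also have "\<dots> \<le> card (S - {s0}) + card (Fib s0 - {y0})"
    using finS finF by (intro add_mono card_image_le) auto
  also have "\<dots> \<le> Q - 1" using sum_le s0(1) y0 finS finF by simp
  finally have "card F \<le> Q - 1" .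
  moreover have ex_s1: "S - {s0} \<noteq> {}" using S2 by auto
  then have "F \<noteq> {}" by (auto simp: F_def)
  moreover have "finite F" by (rule fin)
  ultimately obtain fs where fs: "set fs = F" "length fs = Q - 1"
    using list_of_set_with_length by blast
  show ?thesis
  proof (rule that)
    show "length fs = card (UNIV :: 'a set) - 1" using fs by (simp add: Q_def)
    show "P \<in> T" using P by (simp add: T'_def)
    show "dot3 f P \<noteq> 0" if "f \<in> set fs" for f
      using that P dot3_line_form[of P] dot3_point_form[of P] unfolding fs F_def T'_def by auto
    fix t assume t: "t \<in> T" "\<And>f. f \<in> set fs \<Longrightarrow> dot3 f t \<noteq> 0"
    \<comment> \<open>The centre and the zero vector are covered: every \<open>line_form\<close>
      vanishes there, and \<open>S - {s0}\<close> supplies one.\<close>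
    have "snd t \<noteq> (0, 0)"
      using t(2) ex_s1 dot3_line_form_centre[of t] unfolding fs F_def by blast
    with t(1) have T': "t \<in> T'" by (simp add: T'_def)
    from in_D[OF T'] have "slope t \<in> S" "position t \<in> Fib (slope t)"
      unfolding S_def Fib_def \<phi>_def by force+
    moreover have "slope t = s0"
      using t(2)[unfolded fs F_def] dot3_line_form[OF \<open>snd t \<noteq> (0, 0)\<close>, of "slope t"] \<open>slope t \<in> S\<close>
      by blast
    moreover have "position t = y0"
      using t(2)[unfolded fs F_def] dot3_point_form[OF \<open>snd t \<noteq> (0, 0)\<close>, of "position t"] calculation
      by blast
    ultimately show "\<exists>k. t = scale3 k P"
      using scale3_of_slope_position[OF \<open>snd t \<noteq> (0, 0)\<close>, of P] P by (simp add: T'_def)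
  qed
qed

section \<open>Subspaces over the prime field\<close>

lemma finite_card_vecs:
  "finite (vecs n :: (nat \<Rightarrow> 'a::{finite,field}) set)"
  "card (vecs n :: (nat \<Rightarrow> 'a) set) = card (UNIV :: 'a set) ^ Suc n"
proof -
  let ?E = "PiE {..n} (\<lambda>_. UNIV :: 'a set)"
  have bij: "bij_betw (\<lambda>x. restrict x {..n}) (vecs n) ?E"
    by (rule bij_betw_byWitness[of _ "\<lambda>x i. if i \<le> n then x i else 0"])
      (auto simp: vecs_def restrict_def fun_eq_iff PiE_def extensional_def)
  then show "finite (vecs n :: (nat \<Rightarrow> 'a) set)"
    using bij_betw_finite[OF bij] by (simp add: finite_PiE)
  show "card (vecs n :: (nat \<Rightarrow> 'a) set) = card (UNIV :: 'a set) ^ Suc n"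
    using bij_betw_same_card[OF bij] by (simp add: card_PiE)
qed

lemma finite_fp_subspace:
  "is_fp_subspace n (W :: (nat \<Rightarrow> 'a::{finite,field}) set) \<Longrightarrow> finite W"
  using finite_subset[OF _ finite_card_vecs(1)] by (auto simp: is_fp_subspace_def)

lemma fp_span_subset:
  fixes W :: "(nat \<Rightarrow> 'a::field) set"
  assumes "is_fp_subspace n W" "S \<subseteq> W" "finite S"
  shows "fp_span S \<subseteq> W"
proof -
  have "(\<lambda>i. \<Sum>s\<in>S. of_nat (c s) * s i) \<in> W" for c
    using assms(3,2)
  proof (induction S rule: finite_induct)
    case empty
    then show ?case using assms(1) by (simp add: is_fp_subspace_def)
  next
    case (insert s S)
    then have "(\<lambda>i. of_nat (c s) * s i) \<in> W" "(\<lambda>i. \<Sum>s\<in>S. of_nat (c s) * s i) \<in> W"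
      using assms(1) by (auto simp: is_fp_subspace_def)
    then have "(\<lambda>i. of_nat (c s) * s i + (\<Sum>s\<in>S. of_nat (c s) * s i)) \<in> W"
      using assms(1) unfolding is_fp_subspace_def by fast
    then show ?case using insert by simp
  qed
  then show ?thesis by (auto simp: fp_span_def)
qed

text \<open>A spanning set \<open>S\<close> of least size is independent, because a relation between
  its members would express one of them through the others. Hence each vector of \<open>W\<close>
  has exactly one family of coefficients below \<open>p\<close>.\<close>

lemma card_fp_subspace:
  fixes W :: "(nat \<Rightarrow> 'a::{finite,field}) set"
  assumes p: "prime p" and q: "card (UNIV :: 'a set) = p ^ h" and W: "is_fp_subspace n W"
  shows "card W = p ^ fp_dim W"
proof -
  define spans where "spans d S \<longleftrightarrow> finite S \<and> card S = d \<and> S \<subseteq> W \<and> fp_span S = W"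
    for d :: nat and S :: "(nat \<Rightarrow> 'a) set"
  have dim: "fp_dim W = (LEAST d. \<exists>S. spans d S)"
    by (simp add: fp_dim_def spans_def)
  have finW: "finite W" by (rule finite_fp_subspace[OF W])
  \<comment> \<open>The set \<open>W\<close> spans itself, so the minimum in \<open>fp_dim\<close>
    is attained.\<close>
  have "x \<in> fp_span W" if "x \<in> W" for x
  proof -
    have "x = (\<lambda>i. \<Sum>s\<in>W. of_nat (if s = x then 1 else 0) * s i)"
      using that finW by (simp add: if_distrib[of of_nat] if_distrib[of "\<lambda>y. y * _"] cong: if_cong)
    then show ?thesis
      unfolding fp_span_def mem_Collect_eq by (rule exI[of _ "\<lambda>s. if s = x then 1 else 0"])
  qed
  then have "spans (card W) W"
    using fp_span_subset[OF W order.refl finW] finW by (auto simp: spans_def)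
  then have "\<exists>S. spans (fp_dim W) S"
    unfolding dim by (intro LeastI_ex[where P = "\<lambda>d. \<exists>S. spans d S"] exI)
  then obtain S where S: "finite S" "card S = fp_dim W" "S \<subseteq> W" "fp_span S = W"
    by (auto simp: spans_def)
  have least: "\<not> spans d S'" if "d < fp_dim W" for d S'
    using not_less_Least[of d "\<lambda>d. \<exists>S. spans d S"] that unfolding dim by blast
  have p0: "of_nat p = (0::'a)" by (rule of_nat_prime_eq_0[OF p q])
  have Q2: "card (UNIV :: 'a set) \<ge> 2"
    using card_mono[of UNIV "{0, 1::'a}"] by simp
  define \<Phi> where "\<Phi> c = (\<lambda>i. \<Sum>s\<in>S. of_nat (c s) * s i)" for c :: "(nat \<Rightarrow> 'a) \<Rightarrow> nat"
  have "inj_on \<Phi> (PiE S (\<lambda>_. {..<p}))"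
  proof (rule inj_onI, rule ccontr)
    fix c c' assume c: "c \<in> PiE S (\<lambda>_. {..<p})" "c' \<in> PiE S (\<lambda>_. {..<p})"
      and eq: "\<Phi> c = \<Phi> c'" and "c \<noteq> c'"
    then obtain s where s: "s \<in> S" "c s \<noteq> c' s" by (metis PiE_ext)
    define \<delta> where "\<delta> t = (of_nat (c t) - of_nat (c' t) :: 'a)" for t
    have "\<delta> s \<noteq> 0"
      using inj_on_of_nat_less_prime[OF p q] s c unfolding \<delta>_def inj_on_def by (auto simp: PiE_iff)
    \<comment> \<open>Coefficients in \<open>fp_span\<close> are natural numbers, so negatives are
      represented through \<open>p - c t\<close>, using that \<open>p\<close> is 0 in the
      field.\<close>
    have nat1: "of_nat (c t + (p - c' t)) = \<delta> t" "of_nat (c' t + (p - c t)) = - \<delta> t" if "t \<in> S" for t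
      using c that p0 by (auto simp: \<delta>_def PiE_iff of_nat_diff less_imp_le)
    \<comment> \<open>A natural number that acts as the inverse of \<open>\<delta> s\<close>: the
      power is chosen so that one more factor gives the exponent of Fermat's theorem.\<close>
    define e where "e = (c s + (p - c' s)) ^ (card (UNIV :: 'a set) - 2)"
    have "of_nat e * \<delta> s = \<delta> s ^ Suc (card (UNIV :: 'a set) - 2)"
      unfolding e_def of_nat_power nat1(1)[OF s(1)] by simp
    also have "Suc (card (UNIV :: 'a set) - 2) = card (UNIV :: 'a set) - 1" using Q2 by simp
    finally have e: "of_nat e * \<delta> s = 1" using power_card_minus_1[OF \<open>\<delta> s \<noteq> 0\<close>] by simp
    define k where "k t = e * (c' t + (p - c t))" for t
    have k: "of_nat (k t) = - (of_nat e * \<delta> t)" if "t \<in> S" for t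
      unfolding k_def of_nat_mult nat1(2)[OF that] by simp
    have s_eq: "s i = (\<Sum>t\<in>S - {s}. of_nat (k t) * t i)" for i
    proof -
      have "(\<Sum>t\<in>S. \<delta> t * t i) = 0"
        using fun_cong[OF eq, of i] by (simp add: \<Phi>_def \<delta>_def algebra_simps sum_subtractf)
      then have "\<delta> s * s i = - (\<Sum>t\<in>S - {s}. \<delta> t * t i)"
        using s S(1) by (simp add: sum.remove[of S s] eq_neg_iff_add_eq_0)
      then have "of_nat e * (\<delta> s * s i) = - (\<Sum>t\<in>S - {s}. of_nat e * \<delta> t * t i)"
        by (simp add: sum_distrib_left mult.assoc)
      also have "\<dots> = (\<Sum>t\<in>S - {s}. of_nat (k t) * t i)"
        by (simp add: sum_negf[symmetric] k)
      finally show ?thesis using e by (simp add: mult.assoc[symmetric])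
    qed
    have "fp_span (S - {s}) = W"
    proof
      show "fp_span (S - {s}) \<subseteq> W"
        using fp_span_subset[OF W, of "S - {s}"] S by blast
      show "W \<subseteq> fp_span (S - {s})"
      proof
        fix x assume "x \<in> W"
        then obtain g where g: "x = (\<lambda>i. \<Sum>t\<in>S. of_nat (g t) * t i)"
          using S(4) by (auto simp: fp_span_def)
        have "x i = (\<Sum>t\<in>S - {s}. of_nat (g s * k t + g t) * t i)" for i
        proof -
          have "x i = of_nat (g s) * s i + (\<Sum>t\<in>S - {s}. of_nat (g t) * t i)"
            unfolding g using s S(1) by (simp add: sum.remove[of S s])
          also have "\<dots> = (\<Sum>t\<in>S - {s}. of_nat (g s) * (of_nat (k t) * t i) + of_nat (g t) * t i)"
            by (subst s_eq) (simp add: sum.distrib sum_distrib_left)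
          finally show ?thesis by (simp add: algebra_simps)
        qed
        then show "x \<in> fp_span (S - {s})"
          unfolding fp_span_def mem_Collect_eq by (intro exI[of _ "\<lambda>t. g s * k t + g t"] ext)
      qed
    qed
    then have "spans (card (S - {s})) (S - {s})" using S by (auto simp: spans_def)
    moreover have "card (S - {s}) < fp_dim W"
      using card_Diff1_less[OF S(1) s(1)] S(2) by simp
    ultimately show False using least by blast
  qed
  moreover have "\<Phi> ` PiE S (\<lambda>_. {..<p}) = W"
  proof
    show "\<Phi> ` PiE S (\<lambda>_. {..<p}) \<subseteq> W"
      using S(4) by (auto simp: \<Phi>_def fp_span_def)
    show "W \<subseteq> \<Phi> ` PiE S (\<lambda>_. {..<p})"
    proof
      fix x assume "x \<in> W"
      then obtain g where g: "x = (\<lambda>i. \<Sum>t\<in>S. of_nat (g t) * t i)"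
        using S(4) by (auto simp: fp_span_def)
      have mod: "of_nat (k mod p) = (of_nat k :: 'a)" for k
      proof -
        have "(of_nat k :: 'a) = of_nat (p * (k div p) + k mod p)" by simp
        then show ?thesis unfolding of_nat_add of_nat_mult p0 by simp
      qed
      define g' where "g' = restrict (\<lambda>t. g t mod p) S"
      have "x = \<Phi> g'" unfolding g \<Phi>_def g'_def by (simp add: mod)
      moreover have "g' \<in> PiE S (\<lambda>_. {..<p})"
        using prime_gt_0_nat[OF p] by (auto simp: g'_def)
      ultimately show "x \<in> \<Phi> ` PiE S (\<lambda>_. {..<p})" by blast
    qed
  qed
  ultimately have "card W = card (PiE S (\<lambda>_. {..<p}))" using card_image by fastforce
  then show ?thesis using S by (simp add: card_PiE)
qed

section \<open>Linear algebra over the whole field\<close>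

definition fscale :: "'a::field \<Rightarrow> (nat \<Rightarrow> 'a) \<Rightarrow> nat \<Rightarrow> 'a" where
  "fscale c x = (\<lambda>i. c * x i)"

lemma vector_space_fscale: "vector_space (fscale :: 'a::field \<Rightarrow> _)"
  by unfold_locales (auto simp: fscale_def fun_eq_iff algebra_simps)

text \<open>From here on \<open>fvec.subspace\<close> refers to scalars from the whole field,
  whereas \<open>is_fp_subspace\<close> refers to the prime field.\<close>

interpretation fvec: vector_space "fscale :: 'a::field \<Rightarrow> (nat \<Rightarrow> 'a) \<Rightarrow> nat \<Rightarrow> 'a"
  by (rule vector_space_fscale)

lemma fscale_apply [simp]: "fscale c x i = c * x i"
  by (simp add: fscale_def)

lemma subspace_vecs: "fvec.subspace (vecs n)"
  by (auto simp: fvec.subspace_def vecs_def)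

lemma is_fp_subspace_iff:
  "is_fp_subspace n U \<longleftrightarrow> U \<subseteq> vecs n \<and> 0 \<in> U \<and> (\<forall>x\<in>U. \<forall>y\<in>U. x + y \<in> U) \<and>
     (\<forall>x\<in>U. \<forall>k::nat. fscale (of_nat k) x \<in> U)"
  by (simp add: is_fp_subspace_def zero_fun_def plus_fun_def fscale_def)

lemma is_fp_subspace_Int:
  assumes "is_fp_subspace n U" "fvec.subspace X"
  shows "is_fp_subspace n (U \<inter> X)"
  unfolding is_fp_subspace_iff
proof (intro conjI ballI allI)
  show "U \<inter> X \<subseteq> vecs n" "0 \<in> U \<inter> X"
    using assms by (auto simp: is_fp_subspace_iff fvec.subspace_0)
  show "x + y \<in> U \<inter> X" if "x \<in> U \<inter> X" "y \<in> U \<inter> X" for x y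
    using assms that by (simp add: is_fp_subspace_iff fvec.subspace_add)
  show "fscale (of_nat k) x \<in> U \<inter> X" if "x \<in> U \<inter> X" for x and k :: nat
    using assms that by (simp add: is_fp_subspace_iff fvec.subspace_scale)
qed

lemma diff_closed_subspace: "fvec.subspace X \<Longrightarrow> diff_closed X"
  by (auto simp: diff_closed_def fvec.subspace_0 fvec.subspace_diff)

text \<open>Negation is multiplication by the natural number \<open>p - 1\<close>.\<close>

lemma diff_closed_fp_subspace:
  fixes U :: "(nat \<Rightarrow> 'a::{finite,field}) set"
  assumes p: "prime p" and q: "card (UNIV :: 'a set) = p ^ h" and U: "is_fp_subspace n U"
  shows "diff_closed U"
  unfolding diff_closed_def
proof (intro conjI ballI)
  show "0 \<in> U" using U by (simp add: is_fp_subspace_iff)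
  fix x y assume "x \<in> U" "y \<in> U"
  then have "x + fscale (of_nat (p - 1)) y \<in> U" using U by (simp add: is_fp_subspace_iff)
  moreover have "of_nat (p - 1) = (-1::'a)"
    using of_nat_prime_eq_0[OF p q] prime_gt_0_nat[OF p] by (simp add: of_nat_diff)
  moreover have "x + fscale (-1) y = x - y" by (simp add: fun_eq_iff)
  ultimately show "x - y \<in> U" by simp
qed

lemma sum_fun_apply: "(\<Sum>a\<in>A. f a) i = (\<Sum>a\<in>A. f a i)"
  by (induction A rule: infinite_finite_induct) auto

text \<open>A basis of \<open>K\<close> stays independent when \<open>z\<close> is added, so some
  linear functional is 1 at \<open>z\<close> and 0 on \<open>K\<close>; its values at the unit
  vectors are the coefficients \<open>a\<close>. Geometrically, a proper subspace lies in a
  hyperplane.\<close>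

lemma exists_annihilator:
  fixes K :: "(nat \<Rightarrow> 'a::field) set"
  assumes K: "fvec.subspace K" "K \<subseteq> vecs n" and z: "z \<in> vecs n" "z \<notin> K"
  obtains a where "a \<in> vecs n" "a \<noteq> (\<lambda>i. 0)" "\<And>x. x \<in> K \<Longrightarrow> (\<Sum>i\<le>n. a i * x i) = 0"
proof -
  interpret VP: vector_space_pair "fscale :: 'a \<Rightarrow> _" "(*) :: 'a \<Rightarrow> 'a \<Rightarrow> 'a"
    by unfold_locales (simp_all add: distrib_left distrib_right mult.assoc)
  obtain S where S: "S \<subseteq> K" "fvec.independent S" "K \<subseteq> fvec.span S"
    by (rule fvec.basis_exists)
  have spanS: "fvec.span S = K" using S K(1) fvec.span_minimal[of S K] by blast
  then have "fvec.independent (insert z S)"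
    using S z by (intro fvec.independent_insertI) auto
  from VP.linear_independent_extend[OF this, of "\<lambda>x. if x = z then 1 else 0"]
  obtain g where g: "Vector_Spaces.linear fscale (*) g" "\<And>x. x \<in> insert z S \<Longrightarrow> g x = (if x = z then 1 else 0)"
    by blast
  have "g s = 0" if "s \<in> S" for s
    using g(2)[of s] S(1) z(2) that by auto
  then have gK: "g x = 0" if "x \<in> K" for x
    using VP.linear_eq_0_on_span[OF g(1), of S x] that spanS by blast
  define unit :: "nat \<Rightarrow> nat \<Rightarrow> 'a" where "unit i = (\<lambda>j. if j = i then 1 else 0)" for i
  define a where "a i = (if i \<le> n then g (unit i) else 0)" for i
  have expand: "g x = (\<Sum>i\<le>n. a i * x i)" if "x \<in> vecs n" for x
  proof -
    have "x = (\<Sum>i\<le>n. fscale (x i) (unit i))"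
    proof
      fix j
      have "(\<Sum>i\<le>n. fscale (x i) (unit i)) j = (\<Sum>i\<le>n. if j = i then x i else 0)"
        unfolding sum_fun_apply unit_def by (intro sum.cong) auto
      also have "\<dots> = x j" using that by (simp add: vecs_def)
      finally show "x j = (\<Sum>i\<le>n. fscale (x i) (unit i)) j" by (rule sym)
    qed
    then have "g x = g (\<Sum>i\<le>n. fscale (x i) (unit i))" by simp
    also have "\<dots> = (\<Sum>i\<le>n. x i * g (unit i))"
      by (simp add: VP.linear_sum[OF g(1)] VP.linear_scale[OF g(1)])
    also have "\<dots> = (\<Sum>i\<le>n. a i * x i)"
      by (intro sum.cong) (auto simp: a_def)
    finally show ?thesis .
  qed
  have "g z = 1" using g(2) by simp
  show ?thesis
  proof (rule that)
    show "a \<in> vecs n" by (simp add: vecs_def a_def)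
    show "a \<noteq> (\<lambda>i. 0)" using expand[OF z(1)] \<open>g z = 1\<close> by auto
    show "(\<Sum>i\<le>n. a i * x i) = 0" if "x \<in> K" for x
      using expand[of x] gK[OF that] K(2) that by (metis subsetD)
  qed
qed

section \<open>Points and hyperplanes\<close>

definition dot :: "nat \<Rightarrow> (nat \<Rightarrow> 'a::field) \<Rightarrow> (nat \<Rightarrow> 'a) \<Rightarrow> 'a" where
  "dot n a x = (\<Sum>i\<le>n. a i * x i)"

lemma dot_0 [simp]: "dot n a 0 = 0"
  by (simp add: dot_def)

lemma dot_add [simp]: "dot n a (x + y) = dot n a x + dot n a y"
  by (simp add: dot_def distrib_left sum.distrib)

lemma dot_fscale [simp]: "dot n a (fscale k x) = k * dot n a x"
  by (simp add: dot_def sum_distrib_left mult_ac)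

definition ray :: "(nat \<Rightarrow> 'a::field) \<Rightarrow> (nat \<Rightarrow> 'a) set" where
  "ray x = range (\<lambda>c. fscale c x)"

lemma subspace_ray: "fvec.subspace (ray x)"
  using fvec.subspace_span[of "{x}"] by (simp add: ray_def fvec.span_singleton)

lemma card_ray:
  fixes x :: "nat \<Rightarrow> 'a::{finite,field}"
  assumes "x \<noteq> 0" shows "card (ray x) = card (UNIV :: 'a set)"
proof -
  have "inj (\<lambda>c. fscale c x)"
    using assms by (intro injI) (simp add: fvec.scale_right_imp_eq)
  then show ?thesis unfolding ray_def by (rule card_image)
qed

lemma ray_subset: "fvec.subspace X \<Longrightarrow> x \<in> X \<Longrightarrow> ray x \<subseteq> X"
  by (auto simp: ray_def fvec.subspace_scale)

lemma pg_points_eq: "pg_points n = ray ` (vecs n - {0})"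
  by (auto simp: pg_points_def ray_def fscale_def full_SetCompr_eq zero_fun_def)

definition hyperplane :: "nat \<Rightarrow> (nat \<Rightarrow> 'a::field) \<Rightarrow> (nat \<Rightarrow> 'a) set set" where
  "hyperplane n a = {P \<in> pg_points n. \<forall>x\<in>P. dot n a x = 0}"

lemma pg_hyperplanes_eq: "pg_hyperplanes n = hyperplane n ` (vecs n - {0})"
  by (auto simp: pg_hyperplanes_def hyperplane_def dot_def zero_fun_def)

lemma ray_in_hyperplane:
  assumes "x \<in> vecs n" "x \<noteq> 0"
  shows "ray x \<in> hyperplane n a \<longleftrightarrow> dot n a x = 0"
proof -
  have "x \<in> ray x" unfolding ray_def by (rule image_eqI[of _ _ 1]) auto
  then show ?thesis using assms by (auto simp: hyperplane_def pg_points_eq ray_def)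
qed

lemma ray_in_B_of:
  assumes "x \<in> vecs n" "x \<noteq> 0"
  shows "ray x \<in> B_of n U \<longleftrightarrow> (\<exists>k. k \<noteq> 0 \<and> fscale k x \<in> U)"
  using assms by (auto simp: B_of_def pg_points_eq ray_def zero_fun_def[symmetric])

text \<open>Write q for the field size. A point of the hyperplane has q vectors, \<open>U\<close>
  has \<open>p * q ^ (n - 1)\<close>, and both lie in a space of at most \<open>q ^ n\<close>
  vectors. So they share at least \<open>p\<close> vectors, one of them nonzero, and every point of
  the hyperplane belongs to \<open>B_of n U\<close>.\<close>

lemma B_of_in_pg_hyperplanes:
  fixes U :: "(nat \<Rightarrow> 'a::{finite,field}) set"
  assumes p: "prime p" and q: "card (UNIV :: 'a set) = p ^ h"
    and U: "is_fp_subspace n U" and cardU: "card U = p * card (UNIV :: 'a set) ^ (n - 1)"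
    and n: "n \<ge> 1" and a: "a \<in> vecs n" "a \<noteq> 0" and Ua: "\<And>x. x \<in> U \<Longrightarrow> dot n a x = 0"
  shows "B_of n U \<in> pg_hyperplanes n"
proof -
  define Q where "Q = card (UNIV :: 'a set)"
  define H where "H = {x \<in> vecs n. dot n a x = 0}"
  have Q0: "Q > 0" unfolding Q_def by (simp add: card_gt_0_iff)
  have subH: "fvec.subspace H"
    using subspace_vecs[of n] by (auto simp: H_def fvec.subspace_def)
  have finV: "finite (vecs n :: (nat \<Rightarrow> 'a) set)" by (rule finite_card_vecs)
  have finH: "finite H" using finite_subset[OF _ finV] by (auto simp: H_def)
  have cardH: "card H \<le> Q ^ n"
  proof -
    obtain i where i: "a i \<noteq> 0" using a(2) by (auto simp: fun_eq_iff)
    then have "i \<le> n" using a(1) by (auto simp: vecs_def intro: leI)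
    \<comment> \<open>The ray of a unit vector at a coordinate where \<open>a\<close> is nonzero
      meets \<open>H\<close> only in 0, so the intersection count bounds
      \<open>card H\<close>.\<close>
    define e :: "nat \<Rightarrow> 'a" where "e = (\<lambda>j. if j = i then 1 else 0)"
    have e: "e \<in> vecs n" "e \<noteq> 0" "dot n a e = a i"
      using \<open>i \<le> n\<close> by (auto simp: e_def vecs_def fun_eq_iff dot_def if_distrib cong: if_cong)
    have "H \<inter> ray e = {0}"
      using fvec.subspace_0[OF subH] fvec.subspace_0[OF subspace_ray[of e]] e(3) i
      by (auto simp: H_def ray_def)
    moreover have "card H * card (ray e) \<le> card (vecs n :: (nat \<Rightarrow> 'a) set) * card (H \<inter> ray e)"
      by (rule card_mult_le_card_Int)
        (use finV e ray_subset[OF subspace_vecs] subH subspace_ray subspace_vecs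
          in \<open>auto simp: H_def intro!: diff_closed_subspace\<close>)
    ultimately have "card H * Q \<le> Q ^ n * Q"
      using e by (simp add: card_ray finite_card_vecs Q_def mult.commute)
    then show ?thesis using Q0 by simp
  qed
  have meets: "\<exists>k. k \<noteq> 0 \<and> fscale k x \<in> U" if x: "x \<in> H" "x \<noteq> 0" for x
  proof -
    have "U \<subseteq> H" using U Ua by (auto simp: H_def is_fp_subspace_iff)
    then have "card (ray x) * card U \<le> card H * card (ray x \<inter> U)"
      using finH x(1) ray_subset[OF subH] diff_closed_fp_subspace[OF p q U]
        diff_closed_subspace[OF subspace_ray[of x]] diff_closed_subspace[OF subH]
      by (intro card_mult_le_card_Int) auto
    also have "\<dots> \<le> Q ^ n * card (ray x \<inter> U)" using cardH by simp
    also have "card (ray x) * card U = p * Q ^ Suc (n - 1)"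
      using x(2) cardU by (simp add: card_ray Q_def)
    finally have "Q ^ n * p \<le> Q ^ n * card (ray x \<inter> U)" using n by (simp add: mult.commute)
    then have "p \<le> card (ray x \<inter> U)" using Q0 by simp
    then have "card (ray x \<inter> U) \<ge> 2" using prime_ge_2_nat[OF p] by simp
    then have "\<not> ray x \<inter> U \<subseteq> {0}"
      using card_mono[of "{0 :: nat \<Rightarrow> 'a}" "ray x \<inter> U"] by auto
    then show ?thesis by (auto simp: ray_def)
  qed
  have "B_of n U = hyperplane n a"
  proof (rule set_eqI)
    fix P
    have "P \<in> B_of n U \<longleftrightarrow> P \<in> hyperplane n a" if x: "P = ray x" "x \<in> vecs n" "x \<noteq> 0" for x
    proof -
      have "dot n a x = 0" if "k \<noteq> 0" "fscale k x \<in> U" for k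
        using Ua[OF that(2)] that(1) by simp
      then show ?thesis
        using x meets[of x] by (auto simp: ray_in_hyperplane ray_in_B_of H_def)
    qed
    moreover have "P \<in> pg_points n" if "P \<in> B_of n U \<or> P \<in> hyperplane n a"
      using that by (auto simp: B_of_def hyperplane_def)
    ultimately show "P \<in> B_of n U \<longleftrightarrow> P \<in> hyperplane n a"
      unfolding pg_points_eq by blast
  qed
  then show ?thesis using a by (auto simp: pg_hyperplanes_eq)
qed

section \<open>A plane of small rank\<close>

text \<open>If every line joining two points of \<open>B_of n U\<close> lay inside it, the multiples
  \<open>K\<close> of vectors of \<open>U\<close> would form a subspace over the whole field. It is
  too small to be everything, so a hyperplane would contain \<open>U\<close>. As
  \<open>k = 0\<close> is allowed in the conclusion, the combination of \<open>u\<close> and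
  \<open>v\<close> is nonzero.\<close>

lemma exists_secant_not_contained:
  fixes U :: "(nat \<Rightarrow> 'a::{finite,field}) set"
  assumes U: "is_fp_subspace n U" and small: "card (UNIV :: 'a set) * card U < card (UNIV :: 'a set) ^ Suc n"
    and no_hyp: "\<And>a. a \<in> vecs n \<Longrightarrow> a \<noteq> 0 \<Longrightarrow> \<exists>x\<in>U. dot n a x \<noteq> 0"
  obtains u v c d where "u \<in> U" "v \<in> U"
    "\<And>k x. x \<in> U \<Longrightarrow> fscale c u + fscale d v \<noteq> fscale k x"
proof (rule ccontr)
  note witness = that
  assume "\<not> thesis"
  then have closed: "\<exists>k x. x \<in> U \<and> fscale c u + fscale d v = fscale k x"
    if "u \<in> U" "v \<in> U" for u v c d
    using that witness[of u v c d] by blast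
  define K where "K = (\<lambda>(k, x). fscale k x) ` (UNIV \<times> U)"
  have finU: "finite U" by (rule finite_fp_subspace[OF U])
  have subK: "fvec.subspace K"
    unfolding fvec.subspace_def
  proof (intro conjI ballI allI)
    show "0 \<in> K"
      unfolding K_def using U by (intro image_eqI[of _ _ "(0, 0)"]) (auto simp: is_fp_subspace_iff)
    show "x + y \<in> K" if xy: "x \<in> K" "y \<in> K" for x y
    proof -
      obtain k u l v where "u \<in> U" "v \<in> U" "x = fscale k u" "y = fscale l v"
        using xy unfolding K_def by auto
      with closed[of u v k l] obtain m w where "w \<in> U" "x + y = fscale m w" by auto
      then show ?thesis unfolding K_def by (intro image_eqI[of _ _ "(m, w)"]) auto
    qed
    show "fscale c x \<in> K" if x: "x \<in> K" for c x
    proof -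
      obtain k u where "u \<in> U" "x = fscale k u" using x unfolding K_def by auto
      then show ?thesis unfolding K_def by (intro image_eqI[of _ _ "(c * k, u)"]) auto
    qed
  qed
  have "card K \<le> card (UNIV :: 'a set) * card U"
    unfolding K_def using card_image_le[of "UNIV \<times> U" "\<lambda>(k, x). fscale k x"] finU by (simp add: card_cartesian_product)
  also have "\<dots> < card (vecs n :: (nat \<Rightarrow> 'a) set)" using small by (simp add: finite_card_vecs)
  finally have "\<not> vecs n \<subseteq> K"
    using card_mono[of K "vecs n"] finU by (auto simp: K_def)
  then obtain z where z: "z \<in> vecs n" "z \<notin> K" by blast
  have "K \<subseteq> vecs n"
    using U subspace_vecs by (auto simp: K_def is_fp_subspace_iff intro!: fvec.subspace_scale)
  from exists_annihilator[OF subK this z] obtain a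
    where a: "a \<in> vecs n" "a \<noteq> (\<lambda>i. 0)" "\<And>x. x \<in> K \<Longrightarrow> (\<Sum>i\<le>n. a i * x i) = 0" by blast
  have "U \<subseteq> K"
  proof
    fix x assume "x \<in> U"
    then show "x \<in> K" unfolding K_def by (intro image_eqI[of _ _ "(1, x)"]) auto
  qed
  then show False using no_hyp[of a] a by (auto simp: dot_def zero_fun_def)
qed

text \<open>Given by coordinates, since forms are transported along them. Degenerate triples are
  allowed: \<open>plane u v 0\<close> is the span of \<open>u\<close> and \<open>v\<close>.\<close>

definition plane :: "(nat \<Rightarrow> 'a::field) \<Rightarrow> (nat \<Rightarrow> 'a) \<Rightarrow> (nat \<Rightarrow> 'a) \<Rightarrow> (nat \<Rightarrow> 'a) set" where
  "plane u v w = range (\<lambda>(a, b, c). fscale a u + fscale b v + fscale c w)"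

lemma mem_plane: "x \<in> plane u v w \<longleftrightarrow> (\<exists>a b c. x = fscale a u + fscale b v + fscale c w)"
  unfolding plane_def image_iff by auto

lemma subspace_plane: "fvec.subspace (plane u v w)"
  unfolding fvec.subspace_def mem_plane
proof (intro conjI ballI allI)
  have "0 = fscale 0 u + fscale 0 v + fscale 0 w" by simp
  then show "\<exists>a b c. 0 = fscale a u + fscale b v + fscale c w" by blast
next
  fix x y assume "x \<in> plane u v w" "y \<in> plane u v w"
  then obtain a b c a' b' c' where "x = fscale a u + fscale b v + fscale c w"
    "y = fscale a' u + fscale b' v + fscale c' w" unfolding mem_plane by blast
  then have "x + y = fscale (a + a') u + fscale (b + b') v + fscale (c + c') w"
    by (simp add: fvec.scale_left_distrib add_ac)
  then show "\<exists>a b c. x + y = fscale a u + fscale b v + fscale c w" by blast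
next
  fix k x assume "x \<in> plane u v w"
  then obtain a b c where "x = fscale a u + fscale b v + fscale c w" unfolding mem_plane by blast
  then have "fscale k x = fscale (k * a) u + fscale (k * b) v + fscale (k * c) w"
    by (simp add: fvec.scale_right_distrib)
  then show "\<exists>a b c. fscale k x = fscale a u + fscale b v + fscale c w" by blast
qed

lemma plane_least:
  assumes "fvec.subspace X" "u \<in> X" "v \<in> X" "w \<in> X"
  shows "plane u v w \<subseteq> X"
  using assms by (auto simp: plane_def intro!: fvec.subspace_add fvec.subspace_scale)

lemma in_plane: "u \<in> plane u v w" "v \<in> plane u v w" "w \<in> plane u v w"
proof -
  have "u = fscale 1 u + fscale 0 v + fscale 0 w" "v = fscale 0 u + fscale 1 v + fscale 0 w"
    "w = fscale 0 u + fscale 0 v + fscale 1 w" by simp_all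
  then show "u \<in> plane u v w" "v \<in> plane u v w" "w \<in> plane u v w" unfolding mem_plane by blast+
qed

text \<open>A double count over the planes through the line \<open>L\<close> spanned by
  \<open>u\<close> and \<open>v\<close>. Each of them meets \<open>U\<close> outside
  \<open>L\<close>. If none were small, each would hold at least \<open>p ^ 2 * Q\<close> vectors of
  \<open>U\<close>, of which at most \<open>Q\<close> lie in \<open>L\<close>, and together they
  would hold more than \<open>card U\<close>.\<close>

lemma exists_small_plane:
  fixes U :: "(nat \<Rightarrow> 'a::{finite,field}) set"
  assumes p: "prime p" and q: "card (UNIV :: 'a set) = p ^ h" and n: "n \<ge> 2"
    and U: "is_fp_subspace n U" and cardU: "card U = p * card (UNIV :: 'a set) ^ (n - 1)"
    and uv: "u \<in> U" "v \<in> U"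
    and secant: "\<And>k x. x \<in> U \<Longrightarrow> fscale c u + fscale d v \<noteq> fscale k x"
  obtains w where "w \<in> U" "card (U \<inter> plane u v w) \<le> p * card (UNIV :: 'a set)"
    "\<And>a b k. fscale a u + fscale b v + fscale k w = 0 \<Longrightarrow> a = 0 \<and> b = 0 \<and> k = 0"
proof -
  define Q where "Q = card (UNIV :: 'a set)"
  define L where "L = plane u v 0"
  define V where "V = (vecs n :: (nat \<Rightarrow> 'a) set)"
  have p2: "p \<ge> 2" using p by (rule prime_ge_2_nat)
  have Q2: "Q \<ge> 2" unfolding Q_def using card_mono[of UNIV "{0, 1::'a}"] by simp
  have U0: "0 \<in> U" and UV: "U \<subseteq> V" using U by (simp_all add: is_fp_subspace_iff V_def)
  have finV: "finite V" and cardV: "card V = Q ^ Suc n"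
    unfolding V_def Q_def by (rule finite_card_vecs)+
  have subV: "fvec.subspace V" unfolding V_def by (rule subspace_vecs)
  have subL: "fvec.subspace L" unfolding L_def by (rule subspace_plane)
  have finU: "finite U" using UV finV by (rule finite_subset)
  have mem_L: "x \<in> L \<longleftrightarrow> (\<exists>a b. x = fscale a u + fscale b v)" for x
    by (simp add: L_def mem_plane)
  have planeV: "plane u v x \<subseteq> V" if "x \<in> V" for x
    using plane_least[OF subV] uv UV that by blast
  have LV: "L \<subseteq> V" unfolding L_def using planeV fvec.subspace_0[OF subV] by blast
  have finL: "finite L" using LV finV by (rule finite_subset)
  have L_plane: "L \<subseteq> plane u v x" for x
    unfolding L_def by (intro plane_least subspace_plane in_plane fvec.subspace_0)

  \<comment> \<open>If \<open>u\<close> and \<open>v\<close> were dependent, the point of the secant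
    outside the linear set would be a multiple of one of them.\<close>
  have ind2: "a = 0 \<and> b = 0" if eq: "fscale a u + fscale b v = 0" for a b
  proof (rule ccontr)
    assume "\<not> (a = 0 \<and> b = 0)"
    moreover have False if "b \<noteq> 0"
    proof -
      have "v i = - (a / b) * u i" for i
        using fun_cong[OF eq, of i] that by (simp add: field_simps eq_neg_iff_add_eq_0 add.commute)
      then have "fscale c u + fscale d v = fscale (c - d * a / b) u"
        by (simp add: fun_eq_iff algebra_simps)
      then show False using secant[OF uv(1)] by blast
    qed
    moreover have False if "b = 0" "a \<noteq> 0"
    proof -
      have "u = 0" using eq that by simp
      then have "fscale c u + fscale d v = fscale d v" by simp
      then show False using secant[OF uv(2)] by blast
    qed
    ultimately show False by blast
  qed
  have cardL: "card L = Q\<^sup>2"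
  proof -
    let ?f = "\<lambda>(a, b). fscale a u + fscale b v"
    have "L = range ?f" unfolding set_eq_iff mem_L image_iff by simp
    moreover have "inj ?f"
    proof (rule injI, clarsimp)
      fix a b a' b' assume "fscale a u + fscale b v = fscale a' u + fscale b' v"
      then have "fscale (a - a') u + fscale (b - b') v = 0"
        by (simp add: fvec.scale_left_diff_distrib algebra_simps)
      from ind2[OF this] show "a = a' \<and> b = b'" by simp
    qed
    ultimately have "card L = card (UNIV \<times> UNIV :: ('a \<times> 'a) set)"
      by (simp add: card_image)
    then show ?thesis by (simp only: card_cartesian_product Q_def power2_eq_square)
  qed
  \<comment> \<open>The point \<open>z\<close> of the secant is outside the linear set, so its ray
    shares only 0 with \<open>U\<close>; the intersection count inside \<open>L\<close> then gives
    the bound.\<close>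
  have cardUL: "card (U \<inter> L) \<le> Q"
  proof -
    define z where "z = fscale c u + fscale d v"
    have z0: "z \<noteq> 0" using secant[OF U0, of 0] by (simp add: z_def)
    have zL: "z \<in> L" unfolding z_def mem_L by blast
    have "m = 0" if "fscale m z \<in> U" for m
    proof (rule ccontr)
      assume "m \<noteq> 0"
      then have "z = fscale (1 / m) (fscale m z)" by simp
      then show False using secant[OF that] unfolding z_def by blast
    qed
    then have "ray z \<inter> (U \<inter> L) \<subseteq> {0}" by (auto simp: ray_def)
    then have "card (ray z \<inter> (U \<inter> L)) \<le> 1"
      using card_mono[of "{0 :: nat \<Rightarrow> 'a}"] by fastforce
    moreover have "card (ray z) * card (U \<inter> L) \<le> card L * card (ray z \<inter> (U \<inter> L))"
      using diff_closed_subspace[OF subspace_ray[of z]] diff_closed_subspace[OF subL]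
        diff_closed_fp_subspace[OF p q U] ray_subset[OF subL zL] finL
      by (intro card_mult_le_card_Int) (auto intro: diff_closed_Int)
    ultimately have "Q * card (U \<inter> L) \<le> Q\<^sup>2"
      using z0 order.trans[OF _ mult_le_mono2[of _ 1 "Q\<^sup>2"]] by (simp add: card_ray cardL Q_def)
    then show ?thesis using Q2 by (simp add: power2_eq_square)
  qed

  have ind3: "a = 0 \<and> b = 0 \<and> k = 0"
    if eq: "fscale a u + fscale b v + fscale k x = 0" and "x \<notin> L" for a b k x
  proof -
    have "k = 0"
    proof (rule ccontr)
      assume k: "k \<noteq> 0"
      have "x i = - (a / k) * u i + - (b / k) * v i" for i
        using fun_cong[OF eq, of i] k by (simp add: field_simps eq_neg_iff_add_eq_0)
      then have "x = fscale (- (a / k)) u + fscale (- (b / k)) v" by (simp add: fun_eq_iff)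
      then show False using \<open>x \<notin> L\<close> unfolding mem_L by blast
    qed
    then show ?thesis using eq ind2[of a b] by simp
  qed
  have card_plane: "card (plane u v x) = Q ^ 3" if x: "x \<notin> L" for x
  proof -
    let ?f = "\<lambda>(a, b, k). fscale a u + fscale b v + fscale k x"
    have "inj ?f"
    proof (rule injI, clarsimp)
      fix a b k a' b' k'
      assume "fscale a u + fscale b v + fscale k x = fscale a' u + fscale b' v + fscale k' x"
      then have "fscale (a - a') u + fscale (b - b') v + fscale (k - k') x = 0"
        by (simp add: fvec.scale_left_diff_distrib algebra_simps)
      from ind3[OF this x] show "a = a' \<and> b = b' \<and> k = k'" by simp
    qed
    then have "card (plane u v x) = card (UNIV \<times> UNIV \<times> UNIV :: ('a \<times> 'a \<times> 'a) set)"
      unfolding plane_def by (simp add: card_image)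
    then show ?thesis by (simp only: card_cartesian_product Q_def power3_eq_cube mult.assoc)
  qed
  have plane_sym: "x \<in> plane u v y" if y: "y \<in> plane u v x" "y \<notin> L" for x y
  proof -
    obtain a b k where eq: "y = fscale a u + fscale b v + fscale k x"
      using y(1) unfolding mem_plane by blast
    have "k \<noteq> 0"
    proof
      assume "k = 0"
      then have "y = fscale a u + fscale b v" using eq by simp
      then show False using y(2) unfolding mem_L by blast
    qed
    then have "x = fscale (- (a / k)) u + fscale (- (b / k)) v + fscale (1 / k) y"
      using eq by (simp add: fun_eq_iff field_simps)
    then show ?thesis unfolding mem_plane by blast
  qed
  \<comment> \<open>The intersection count yields
    \<open>p * Q ^ (n - 1) * Q ^ 3 / Q ^ (n + 1)\<close>.\<close>
  have lower: "p * Q \<le> card (U \<inter> plane u v x)" if x: "x \<in> V" "x \<notin> L" for x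
  proof -
    have "card U * card (plane u v x) \<le> card V * card (U \<inter> plane u v x)"
      using diff_closed_subspace[OF subspace_plane[of u v x]] diff_closed_subspace[OF subV]
        diff_closed_fp_subspace[OF p q U] finV UV planeV[OF x(1)]
      by (intro card_mult_le_card_Int)
    moreover have "card U * card (plane u v x) = Q ^ Suc n * (p * Q)"
    proof -
      have "Q ^ (n - 1) * Q ^ 3 = Q ^ Suc n * Q"
        using n by (simp flip: power_add power_Suc2)
      then show ?thesis using x by (simp add: card_plane cardU flip: Q_def)
    qed
    ultimately show ?thesis using Q2 by (simp add: cardV)
  qed

  have "\<exists>w\<in>U - L. card (U \<inter> plane u v w) \<le> p * Q"
  proof (rule ccontr)
    assume contr: "\<not> ?thesis"
    \<comment> \<open>Cardinalities here are powers of \<open>p\<close>, so exceeding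
      \<open>p ^ (h + 1)\<close> means reaching \<open>p ^ (h + 2)\<close>.\<close>
    have large: "p\<^sup>2 * Q \<le> card (U \<inter> plane u v w)" if "w \<in> U - L" for w
    proof -
      let ?k = "fp_dim (U \<inter> plane u v w)"
      have card: "card (U \<inter> plane u v w) = p ^ ?k"
        by (rule card_fp_subspace[OF p q is_fp_subspace_Int[OF U subspace_plane]])
      have "p * Q < card (U \<inter> plane u v w)" using contr that by force
      then have "p ^ Suc h < p ^ ?k" by (simp add: card q Q_def)
      then have "Suc h < ?k" using p2 power_less_imp_less_exp[of p "Suc h" ?k] by linarith
      then have "p ^ (h + 2) \<le> p ^ ?k" using p2 by (intro power_increasing) auto
      then show ?thesis by (simp add: card Q_def q power2_eq_square mult_ac)
    qed
    \<comment> \<open>By \<open>lower\<close> and \<open>cardUL\<close> the plane of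
      \<open>x\<close> contains some \<open>w\<close> of \<open>U\<close> outside \<open>L\<close>,
      hence also the plane of \<open>w\<close>, to which \<open>large\<close> applies.\<close>
    have large': "p\<^sup>2 * Q - Q \<le> card {y \<in> U - L. y \<in> plane u v x}" if x: "x \<in> V - L" for x
    proof -
      have "Q < p * Q" using p2 Q2 by simp
      moreover have "p * Q \<le> card (U \<inter> plane u v x)" using lower[of x] x by blast
      ultimately have "card (U \<inter> L) < card (U \<inter> plane u v x)" using cardUL by linarith
      then have "\<not> U \<inter> plane u v x \<subseteq> U \<inter> L"
        using card_mono[of "U \<inter> L" "U \<inter> plane u v x"] finU by auto
      then obtain w where w: "w \<in> U" "w \<in> plane u v x" "w \<notin> L" by blast
      then have "plane u v w \<subseteq> plane u v x"
        by (intro plane_least subspace_plane in_plane)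
      then have "card (U \<inter> plane u v w) \<le> card (U \<inter> plane u v x)"
        using finU by (intro card_mono) auto
      with large[of w] w have "p\<^sup>2 * Q \<le> card (U \<inter> plane u v x)" by simp
      moreover have "card (U \<inter> plane u v x) - card (U \<inter> L) \<le> card (U \<inter> plane u v x - U \<inter> L)"
        using finU by (intro diff_card_le_card_Diff) auto
      moreover have "U \<inter> plane u v x - U \<inter> L = {y \<in> U - L. y \<in> plane u v x}" by auto
      ultimately show ?thesis using cardUL by simp
    qed
    have few: "card {x \<in> V - L. y \<in> plane u v x} \<le> Q ^ 3 - Q\<^sup>2" if y: "y \<in> U - L" for y
    proof -
      have "{x \<in> V - L. y \<in> plane u v x} \<subseteq> plane u v y - L"
        using plane_sym[of y] y by blast
      moreover have "finite (plane u v y)"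
        using finite_subset[OF planeV finV] y UV by blast
      ultimately have "card {x \<in> V - L. y \<in> plane u v x} \<le> card (plane u v y - L)"
        by (intro card_mono) auto
      also have "\<dots> = Q ^ 3 - Q\<^sup>2"
        using y L_plane finL by (subst card_Diff_subset) (auto simp: card_plane cardL)
      finally show ?thesis .
    qed
    \<comment> \<open>Pairs \<open>(x, y)\<close> of vectors outside \<open>L\<close> that span the
      same plane with it, with \<open>y\<close> in \<open>U\<close>, are counted in both ways. Using
      vectors \<open>x\<close> as labels avoids handling a set of planes.\<close>
    have "(\<Sum>x\<in>V - L. card {y \<in> U - L. y \<in> plane u v x}) =
        (\<Sum>y\<in>U - L. card {x \<in> V - L. y \<in> plane u v x})"
      using finV finU by (intro sum_multicount_gen) auto
    moreover have "(\<Sum>x\<in>V - L. p\<^sup>2 * Q - Q) \<le> (\<Sum>x\<in>V - L. card {y \<in> U - L. y \<in> plane u v x})"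
      by (intro sum_mono large')
    moreover have "(\<Sum>y\<in>U - L. card {x \<in> V - L. y \<in> plane u v x}) \<le> (\<Sum>y\<in>U - L. Q ^ 3 - Q\<^sup>2)"
      by (intro sum_mono few)
    ultimately have "card (V - L) * (p\<^sup>2 * Q - Q) \<le> card (U - L) * (Q ^ 3 - Q\<^sup>2)" by simp
    also have "\<dots> \<le> card U * (Q ^ 3 - Q\<^sup>2)"
      using finU by (intro mult_le_mono1 card_mono) auto
    also have "card (V - L) = Q ^ Suc n - Q\<^sup>2"
      using LV finL by (simp add: card_Diff_subset cardV cardL)
    finally have le: "(Q ^ Suc n - Q\<^sup>2) * (p\<^sup>2 * Q - Q) \<le> p * Q ^ (n - 1) * (Q ^ 3 - Q\<^sup>2)"
      by (simp add: cardU Q_def)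
    define A where "A = Q ^ (n - 1)"
    have "Q ^ 1 \<le> A" unfolding A_def using n Q2 by (intro power_increasing) auto
    have Qn: "Q ^ Suc n = A * Q\<^sup>2"
      unfolding A_def power_add[symmetric] using n by (intro arg_cong[of _ _ "power Q"]) simp
    \<comment> \<open>Both sides are factored for a comparison factor by factor:
      \<open>p < p ^ 2 - 1\<close>, and \<open>A * (Q - 1) \<le> (A - 1) * Q\<close> because
      \<open>Q \<le> A\<close>.\<close>
    have "(A * Q\<^sup>2 - Q\<^sup>2) * (p\<^sup>2 * Q - Q) = (Q\<^sup>2 * (p\<^sup>2 - 1)) * ((A - 1) * Q)"
    proof -
      have "A * Q\<^sup>2 - Q\<^sup>2 = (A - 1) * Q\<^sup>2" "p\<^sup>2 * Q - Q = (p\<^sup>2 - 1) * Q"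
        by (simp_all add: diff_mult_distrib)
      then show ?thesis by (simp only: mult_ac)
    qed
    moreover have "p * A * (Q ^ 3 - Q\<^sup>2) = (Q\<^sup>2 * p) * (A * (Q - 1))"
      by (simp add: algebra_simps diff_mult_distrib2 power2_eq_square power3_eq_cube)
    moreover have "A * (Q - 1) \<le> (A - 1) * Q"
      using \<open>Q ^ 1 \<le> A\<close> by (simp add: diff_mult_distrib diff_mult_distrib2)
    moreover have "Q\<^sup>2 * p < Q\<^sup>2 * (p\<^sup>2 - 1)"
    proof -
      have "2 * p \<le> p * p" using p2 by simp
      then have "p < p\<^sup>2 - 1" using p2 unfolding power2_eq_square by linarith
      then show ?thesis using Q2 by simp
    qed
    moreover have "0 < A * (Q - 1)" using \<open>Q ^ 1 \<le> A\<close> Q2 by simp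
    ultimately have "p * A * (Q ^ 3 - Q\<^sup>2) < (A * Q\<^sup>2 - Q\<^sup>2) * (p\<^sup>2 * Q - Q)"
      by (metis mult_less_le_imp_less zero_le)
    then show False using le unfolding Qn A_def[symmetric] by linarith
  qed
  then obtain w where w: "w \<in> U" "w \<notin> L" "card (U \<inter> plane u v w) \<le> p * Q" by blast
  then show ?thesis
    using that[of w] ind3[OF _ w(2)] by (simp add: Q_def)
qed

section \<open>Test functions\<close>

lemma of_int_cong:
  assumes "of_nat p = (0::'a::field)" "[i = j] (mod int p)"
  shows "of_int i = (of_int j :: 'a)"
proof -
  obtain k where "j = i + int p * k" using assms(2) by (auto simp: cong_iff_lin)
  then show ?thesis using assms(1) by simp
qed

text \<open>Pairing with \<open>G\<close> kills every combination of hyperplanes but not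
  \<open>B\<close>. The values of \<open>G\<close> lie in the whole field, where congruences modulo
  \<open>p\<close> become equalities, and sums run over nonzero vectors, so no representatives of
  points are chosen.\<close>

lemma not_in_code_if_test_function:
  fixes G :: "(nat \<Rightarrow> 'a::{finite,field}) \<Rightarrow> 'a" and B :: "(nat \<Rightarrow> 'a) set set"
  assumes p: "prime p" and q: "card (UNIV :: 'a set) = p ^ h"
    and hyp: "\<And>a. a \<in> vecs n - {0} \<Longrightarrow> (\<Sum>x\<in>{x \<in> vecs n - {0}. dot n a x = 0}. G x) = 0"
    and B: "(\<Sum>x\<in>{x \<in> vecs n - {0}. ray x \<in> B}. G x) \<noteq> 0"
  shows "\<not> in_code p n (incvec B)"
proof
  assume "in_code p n (incvec B)"
  then obtain c where c: "\<And>P. P \<in> pg_points n \<Longrightarrow>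
      [incvec B P = (\<Sum>H\<in>pg_hyperplanes n. c H * incvec H P)] (mod int p)"
    unfolding in_code_def by blast
  define X where "X = (vecs n - {0} :: (nat \<Rightarrow> 'a) set)"
  have finX: "finite X" by (simp add: X_def finite_card_vecs)
  have sum_incvec: "(\<Sum>x\<in>X. of_int (incvec A (ray x)) * G x) = (\<Sum>x\<in>{x \<in> X. ray x \<in> A}. G x)" for A
    using finX by (simp add: incvec_def sum.inter_filter if_distrib[of of_int] if_distrib[of "\<lambda>y. y * _"] cong: if_cong)
  have "of_int (incvec B (ray x)) = (\<Sum>H\<in>pg_hyperplanes n. of_int (c H) * (of_int (incvec H (ray x)) :: 'a))"
    if "x \<in> X" for x
    using of_int_cong[OF of_nat_prime_eq_0[OF p q] c[of "ray x"]] that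
    by (simp add: pg_points_eq X_def)
  then have "(\<Sum>x\<in>X. of_int (incvec B (ray x)) * G x) =
      (\<Sum>x\<in>X. \<Sum>H\<in>pg_hyperplanes n. of_int (c H) * (of_int (incvec H (ray x)) * G x))"
    by (intro sum.cong) (simp_all add: sum_distrib_right mult.assoc)
  also have "\<dots> = (\<Sum>H\<in>pg_hyperplanes n. of_int (c H) * (\<Sum>x\<in>X. of_int (incvec H (ray x)) * G x))"
    by (subst sum.swap) (simp add: sum_distrib_left)
  also have "\<dots> = 0"
  proof (rule sum.neutral, rule ballI)
    fix H :: "(nat \<Rightarrow> 'a) set set"
    assume "H \<in> pg_hyperplanes n"
    then obtain a where a: "a \<in> X" "H = hyperplane n a" by (auto simp: pg_hyperplanes_eq X_def)
    have "{x \<in> X. ray x \<in> H} = {x \<in> vecs n - {0}. dot n a x = 0}"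
      by (auto simp: a X_def ray_in_hyperplane)
    then have "(\<Sum>x\<in>{x \<in> X. ray x \<in> H}. G x) = 0" using hyp[of a] a by (simp add: X_def)
    then show "of_int (c H) * (\<Sum>x\<in>X. of_int (incvec H (ray x)) * G x) = 0"
      by (simp add: sum_incvec)
  qed
  finally show False using B unfolding sum_incvec unfolding X_def by simp
qed

section \<open>The test function on the chosen plane\<close>

theorem theorem4:
  fixes p h n :: nat and B :: "(nat \<Rightarrow> 'a::{finite,field}) set set"
  assumes "prime p" and "card (UNIV :: 'a set) = p ^ h" and "h > 1" and "n \<ge> 2"
    and "small_linear_blocking_set h n B"
    and "B \<notin> pg_hyperplanes n"
  shows "\<not> in_code p n (incvec B)"
proof -
  note p = assms(1) and q = assms(2)
  define Q where "Q = card (UNIV :: 'a set)"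
  have p2: "p \<ge> 2" using p by (rule prime_ge_2_nat)
  have Q2: "Q \<ge> 2" unfolding Q_def using card_mono[of UNIV "{0, 1::'a}"] by simp
  obtain U :: "(nat \<Rightarrow> 'a) set"
    where U: "is_fp_subspace n U" and dimU: "fp_dim U = h * (n - 1) + 1" and B: "B = B_of n U"
    using assms(5) unfolding small_linear_blocking_set_def by blast
  have cardU: "card U = p * Q ^ (n - 1)"
    using card_fp_subspace[OF p q U] by (simp add: dimU Q_def q power_mult)
  have no_hyp: "\<exists>x\<in>U. dot n a x \<noteq> 0" if "a \<in> vecs n" "a \<noteq> 0" for a
    using B_of_in_pg_hyperplanes[OF p q U, of a] assms(4,6) cardU that B by (auto simp: Q_def)
  \<comment> \<open>From \<open>h > 1\<close> comes \<open>p < Q\<close>, so the multiples of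
    vectors of \<open>U\<close> are too few to fill the space.\<close>
  have "p ^ 1 < Q" unfolding Q_def q using assms(3) p2 by (intro power_strict_increasing) auto
  then have "p * Q ^ (n - 1) < Q * Q ^ (n - 1)" using Q2 by (intro mult_strict_right_mono) auto
  also have "Q * Q ^ (n - 1) = Q ^ n" using assms(4) by (simp flip: power_Suc)
  finally have "Q * card U < Q ^ Suc n" using Q2 by (simp add: cardU)
  then obtain u v c d where uv: "u \<in> U" "v \<in> U"
    and secant: "\<And>k x. x \<in> U \<Longrightarrow> fscale c u + fscale d v \<noteq> fscale k x"
    using exists_secant_not_contained[OF U, of thesis] no_hyp unfolding Q_def by blast
  obtain w where w: "w \<in> U" "card (U \<inter> plane u v w) \<le> p * Q"
    and ind: "\<And>a b k. fscale a u + fscale b v + fscale k w = 0 \<Longrightarrow> a = 0 \<and> b = 0 \<and> k = 0"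
    using exists_small_plane[OF p q assms(4) U _ uv secant, of thesis] cardU unfolding Q_def by blast

  \<comment> \<open>Coordinates on the plane. The vector \<open>u\<close> becomes
    \<open>(1, 0, 0)\<close>, so the projection is from the point of \<open>u\<close>.\<close>
  define \<psi> where "\<psi> = (\<lambda>(a, b, k). fscale a u + fscale b v + fscale k w)"
  define T where "T = {t. \<psi> t \<in> U}"
  have plane: "plane u v w = range \<psi>" by (simp add: plane_def \<psi>_def)
  have \<psi>_scale: "\<psi> (scale3 k t) = fscale k (\<psi> t)" for k t
    by (cases t) (simp add: \<psi>_def scale3_def fvec.scale_right_distrib)
  have \<psi>_0: "\<psi> t = 0 \<longleftrightarrow> t = (0, 0, 0)" for t
    using ind by (cases t) (auto simp: \<psi>_def)
  have inj: "inj \<psi>"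
  proof (rule injI)
    fix s t assume "\<psi> s = \<psi> t"
    moreover obtain a b k where s: "s = (a, b, k)" by (cases s)
    moreover obtain a' b' k' where t: "t = (a', b', k')" by (cases t)
    ultimately have "\<psi> (a - a', b - b', k - k') = 0"
      by (simp add: \<psi>_def fvec.scale_left_diff_distrib algebra_simps)
    then show "s = t" by (simp add: \<psi>_0 s t)
  qed
  have Uadd: "x + y \<in> U" if "x \<in> U" "y \<in> U" for x y
    using U that by (simp add: is_fp_subspace_iff)
  obtain fs P where fs: "length fs = Q - 1" and P: "P \<in> T" "\<And>f. f \<in> set fs \<Longrightarrow> dot3 f P \<noteq> 0"
    and cover: "\<And>t. t \<in> T \<Longrightarrow> (\<And>f. f \<in> set fs \<Longrightarrow> dot3 f t \<noteq> 0) \<Longrightarrow> \<exists>k. t = scale3 k P"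
  proof (rule exists_covering_forms[OF p q, of T])
    show "(1, 0, 0) \<in> T" "(0, 1, 0) \<in> T" "(0, 0, 1) \<in> T"
      using uv w by (auto simp: T_def \<psi>_def)
    show "(a + 1, b, k) \<in> T" if "(a, b, k) \<in> T" for a b k
    proof -
      have "\<psi> (a + 1, b, k) = \<psi> (a, b, k) + u" by (simp add: \<psi>_def fvec.scale_left_distrib algebra_simps)
      then show ?thesis using that Uadd uv(1) by (simp add: T_def)
    qed
    show "scale3 (of_nat k) t \<in> T" if "t \<in> T" for k t
      using that U by (simp add: T_def \<psi>_scale is_fp_subspace_iff)
    have "card T \<le> card (U \<inter> plane u v w)"
      using inj finite_fp_subspace[OF U]
      by (intro card_inj_on_le[of \<psi>]) (auto simp: T_def plane intro: inj_on_subset)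
    then show "card T \<le> p * card (UNIV :: 'a set)" using w(2) by (simp add: Q_def)
  qed (auto simp: Q_def)

  define g where "g t = (\<Prod>f\<leftarrow>fs. dot3 f t)" for t
  define G where "G x = (if x \<in> range \<psi> then g (inv \<psi> x) else 0)" for x
  have G_\<psi>: "G (\<psi> t) = g t" for t using inj by (simp add: G_def)
  have g_nz: "g t \<noteq> 0 \<longleftrightarrow> (\<forall>f\<in>set fs. dot3 f t \<noteq> 0)" for t
    by (auto simp: g_def prod_list_zero_iff)
  \<comment> \<open>For nonzero \<open>k\<close> the factor \<open>k ^ (Q - 1)\<close> is 1, so
    \<open>g\<close> is constant on the nonzero vectors of a point.\<close>
  have g_scale: "g (scale3 k t) = k ^ (Q - 1) * g t" for k t
    unfolding g_def fs[symmetric] by (induction fs) (auto simp: dot3_scale3 mult_ac)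
  have "fs \<noteq> []" using fs Q2 by auto
  then have g_0: "g (0, 0, 0) = 0"
    using g_scale[of 0 "(0, 0, 0)"] Q2 by (simp add: scale3_def power_0_left)
  \<comment> \<open>The zero vector has value 0, so sums may include it or leave it out.\<close>
  have G_0: "G 0 = 0" using G_\<psi>[of "(0, 0, 0)"] \<psi>_0[of "(0, 0, 0)"] g_0 by simp
  have finV: "finite (vecs n :: (nat \<Rightarrow> 'a) set)" by (rule finite_card_vecs)
  have \<psi>_vecs: "\<psi> t \<in> vecs n" for t
  proof -
    have "plane u v w \<subseteq> vecs n"
      using plane_least[OF subspace_vecs, of u n v w] uv w(1) U by (auto simp: is_fp_subspace_iff)
    then show ?thesis by (auto simp: plane)
  qed

  show ?thesis
  proof (rule not_in_code_if_test_function[OF p q])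
    fix a :: "nat \<Rightarrow> 'a"
    \<comment> \<open>The equation \<open>a\<close> restricted to the plane; it is
      \<open>(0, 0, 0)\<close> when the hyperplane contains the plane.\<close>
    define m where "m = (dot n a u, dot n a v, dot n a w)"
    have dot_\<psi>: "dot n a (\<psi> t) = dot3 m t" for t
      by (cases t) (simp add: \<psi>_def m_def dot3_def mult_ac)
    have "(\<Sum>x\<in>{x \<in> vecs n - {0}. dot n a x = 0}. G x) = (\<Sum>x\<in>\<psi> ` {t. dot3 m t = 0}. G x)"
      by (rule sum.mono_neutral_cong)
        (use finV G_0 \<psi>_vecs in \<open>auto simp: dot_\<psi> G_def inj_eq[OF inj]\<close>)
    also have "\<dots> = (\<Sum>t\<in>{t. dot3 m t = 0}. g t)"
      using inj by (subst sum.reindex) (auto simp: G_\<psi> intro: inj_on_subset)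
    also have "\<dots> = 0"
      unfolding g_def by (rule sum_forms_on_plane_section_eq_0) (use fs Q2 in \<open>simp add: Q_def\<close>)
    finally show "(\<Sum>x\<in>{x \<in> vecs n - {0}. dot n a x = 0}. G x) = 0" .
  next
    have gP: "g P \<noteq> 0" using P by (simp add: g_nz)
    then have P0: "\<psi> P \<noteq> 0" using g_0 by (auto simp: \<psi>_0)
    \<comment> \<open>The nonzero vectors of the uncovered point. Among the vectors of points of
      \<open>B\<close>, the function \<open>G\<close> is supported on them.\<close>
    define R where "R = (\<lambda>k. fscale k (\<psi> P)) ` (UNIV - {0})"
    have R_sub: "R \<subseteq> {x \<in> vecs n - {0}. ray x \<in> B}"
    proof
      fix x assume "x \<in> R"
      then obtain k where k: "k \<noteq> 0" "x = fscale k (\<psi> P)" by (auto simp: R_def)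
      then have "x \<in> vecs n" "x \<noteq> 0"
        using P0 \<psi>_vecs[of P] by (auto intro: fvec.subspace_scale[OF subspace_vecs])
      moreover have "fscale (1 / k) x \<in> U" using k P(1) by (simp add: T_def)
      ultimately show "x \<in> {x \<in> vecs n - {0}. ray x \<in> B}"
        using k(1) by (auto simp: B ray_in_B_of intro!: exI[of _ "1 / k"])
    qed
    have "G x = 0" if x: "x \<in> vecs n" "x \<noteq> 0" "ray x \<in> B" "x \<notin> R" for x
    proof (rule ccontr)
      assume "G x \<noteq> 0"
      then obtain t where t: "x = \<psi> t" "g t \<noteq> 0" by (auto simp: G_def inj split: if_splits)
      \<comment> \<open>A multiple of \<open>x\<close> in \<open>U\<close> avoids the same lines as
        \<open>x\<close>, so \<open>cover\<close> makes it a multiple of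
        \<open>\<psi> P\<close>.\<close>
      obtain k where k: "k \<noteq> 0" "fscale k x \<in> U" using x by (auto simp: B ray_in_B_of)
      then have "scale3 k t \<in> T" by (simp add: T_def \<psi>_scale t)
      moreover have "dot3 f (scale3 k t) \<noteq> 0" if "f \<in> set fs" for f
        using t(2) that k(1) by (simp add: g_nz dot3_scale3)
      ultimately obtain l where "scale3 k t = scale3 l P" using cover by blast
      then have "fscale k x = fscale l (\<psi> P)" by (metis \<psi>_scale t(1))
      then have "fscale (1 / k) (fscale k x) = fscale (1 / k) (fscale l (\<psi> P))" by simp
      then have "x = fscale (l / k) (\<psi> P)" using k(1) by simp
      moreover from this have "l / k \<noteq> 0" using x(2) by auto
      ultimately show False using x(4) by (auto simp: R_def)
    qed
    then have "(\<Sum>x\<in>{x \<in> vecs n - {0}. ray x \<in> B}. G x) = (\<Sum>x\<in>R. G x)"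
      using R_sub finV by (intro sum.mono_neutral_right) auto
    also have "\<dots> = (\<Sum>k\<in>UNIV - {0}. G (fscale k (\<psi> P)))"
      unfolding R_def using P0
      by (subst sum.reindex) (auto simp: inj_on_def intro: fvec.scale_right_imp_eq)
    also have "\<dots> = (\<Sum>k\<in>UNIV - {0 :: 'a}. g P)"
      by (intro sum.cong) (simp_all add: \<psi>_scale[symmetric] G_\<psi> g_scale
          power_card_minus_1[unfolded One_nat_def] Q_def)
    also have "\<dots> = of_nat (Q - 1) * g P" by (simp add: Q_def)
    \<comment> \<open>The number of nonzero vectors on a point is nonzero in the field, so the equal
      terms do not cancel.\<close>
    also have "of_nat (Q - 1) = (- 1 :: 'a)"
    proof -
      have "of_nat Q = (0 :: 'a)"
        using of_nat_prime_eq_0[OF p q] assms(3) by (simp add: Q_def q)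
      then show ?thesis using Q2 by (simp add: of_nat_diff)
    qed
    finally have value_B: "(\<Sum>x\<in>{x \<in> vecs n - {0}. ray x \<in> B}. G x) = - 1 * g P" .
    show "(\<Sum>x\<in>{x \<in> vecs n - {0}. ray x \<in> B}. G x) \<noteq> 0" unfolding value_B using gP by simp
  qed
qed

end
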